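(* Let $n\ge 1$, $m=2n+1$, and let an almost symmetric numerical semigroup $S=S(\mathbf d^{2n+1})$, minimally generated by $\mathbf d^{2n+1}=\{d_1,\dots,d_{2n+1}\}$, be given. With the multisets $\mathfrak L_o,\mathfrak L_e,\mathfrak B_o,\mathfrak B_e,\overline{\mathfrak B}_o,\overline{\mathfrak B}_e$ associated with $S$ as in the context, put $\mathfrak M_{12}=\mathfrak L_e\bigwedge\mathfrak L_o$ and $\mathfrak X_{12}=\left[\mathfrak B_o\bigvee\overline{\mathfrak B}_e\right]\bigwedge\left[\mathfrak B_e\bigvee\overline{\mathfrak B}_o\right]$. Then $$\left[\mathfrak B_o\bigvee\overline{\mathfrak B}_e\right]\setminus\mathfrak X_{12}=\mathfrak L_e\setminus\mathfrak M_{12},\qquad \left[\mathfrak B_e\bigvee\overline{\mathfrak B}_o\right]\setminus\mathfrak X_{12}=\mathfrak L_o\setminus\mathfrak M_{12}.$$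
   Context: Semigroup. Let $d_1<\dots<d_m$ be positive integers with $\gcd(d_1,\dots,d_m)=1$, none a nonnegative integer linear combination of the others, $S=\{\sum_{i=1}^m x_id_i : x_i\in\mathbb Z_{\ge 0}\}$, $F$ the largest integer not in $S$, $\Sigma_m=\sum_{k=1}^m d_k$. Put $S'=\{x\in\mathbb Z : x\notin S,\ x+s\in S \text{ for all } s\in S\setminus\{0\}\}$ and $\Delta_{\mathcal H}=\{h\notin S : F-h\notin S\}$. $S$ is almost symmetric if $S'\setminus\{F\}=\Delta_{\mathcal H}$. Syzygies. Let $k$ be a field of characteristic $0$, and regard $k[z^{d_1},\dots,z^{d_m}]$ as a graded module over $k[X_1,\dots,X_m]$, $\deg X_i=d_i$, via $X_i\mapsto z^{d_i}$. Its Hilbert series is written $\sum_{s\in S}z^s=Q(z)/\prod_{j=1}^m(1-z^{d_j})$ with $Q=1-Q_1+Q_2-\dots+(-1)^{m-1}Q_{m-1}$ and $Q_i(z)=\sum_{j=1}^{\beta_i}z^{C_{j,i}}$ for $1\le i\le m-1$. The summands $z^{C_{j,i}}$ stand for the syzygies of the $i$th kind (those of the $i$th step of the minimal graded free resolution); the positive integers $C_{j,i}$ are the syzygy degrees and the numbers $\beta_i$ of terms the Betti numbers. They are subject to the standing requirements $C_{j+1,i}\ge C_{j,i}$, $C_{\beta_{i+1},i+1}>C_{\beta_i,i}$, $C_{1,i+1}>C_{1,i}$, and $$C_{j,i}\ne C_{r,i+2k-1}\quad\text{for } 1\le j\le\beta_i,\ 1\le r\le\beta_{i+2k-1},\ 1\le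 k\le\lfloor (m-i)/2\rfloor ;$$ the last requirement means that all necessary cancellations of terms $z^{C_{j,i}}$ in the alternating sum $Q$ are already performed. Put $\overline C_{j,i}=F+\Sigma_m-C_{j,i}$. Multiset operations. For finite multisets of integers with multiplicity functions $\sigma_1,\sigma_2$: $\bigvee$ (join) has multiplicity $\sigma_1+\sigma_2$; $\bigwedge$ (intersection) has multiplicity $\min\{\sigma_1,\sigma_2\}$; $\setminus$ (difference, when the second multiset is contained in the first) has multiplicity $\sigma_1-\sigma_2$. Multisets ($m=2n+1$). For $1\le i\le m-1$ let $\mathfrak L_i$ be the multiset of all integers $\sum_{j\in I}d_j+h$, where $I$ runs over the $i$-element subsets of $\{1,\dots,m\}$ and $h$ over $\Delta_{\mathcal H}$, counted with multiplicity (so it has $\binom mi\cdot\#\Delta_{\mathcal H}$ elements). $\mathfrak L_o$ (resp. $\mathfrak L_e$) is the join of all $\mathfrak L_i$ with $i$ odd (resp. even), $1\le i\le m-1$. Let $\mathfrak B_i=\{C_{j,i}:1\le j\le\beta_i\}$ and $\overline{\mathfrak B}_i=\{\overline C_{j,i}:1\le j\le\beta_i\}$ as multisets. Then $\mathfrak B_o=\bigvee_{i=1}^{n}\mathfrak B_{2i-1}$, $\mathfrak B_e=\bigvee_{i=1}^{n-1}\mathfrak B_{2i}$, $\overline{\mathfrak B}_o=\bigvee_{i=1}^{n}\overline{\mathfrak B}_{2i-1}$, $\overline{\mathfrak B}_e=\bigvee_{i=1}^{n-1}\overline{\mathfrak B}_{2i}$ (empty joins are the empty multiset). *)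

theory Defs
  imports Complex_Main
    "HOL-Library.Multiset"
    "HOL-Library.Poly_Mapping"
    "HOL-Computational_Algebra.Polynomial"
begin

section \<open>Numerical semigroups\<close>

definition minimal_generators :: "nat \<Rightarrow> (nat \<Rightarrow> nat) \<Rightarrow> bool" where
  "minimal_generators m d \<longleftrightarrow>
     (\<forall>i\<in>{1..m}. 0 < d i) \<and> strict_mono_on {1..m} d \<and> Gcd (d ` {1..m}) = 1 \<and>
     (\<forall>i\<in>{1..m}. \<not> (\<exists>x :: nat \<Rightarrow> nat. d i = (\<Sum>j\<in>{1..m} - {i}. x j * d j)))"

definition semigroup_of :: "nat \<Rightarrow> (nat \<Rightarrow> nat) \<Rightarrow> int set" where
  "semigroup_of m d = {int (\<Sum>i=1..m. x i * d i) | x :: nat \<Rightarrow> nat. True}"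

definition frobenius :: "int set \<Rightarrow> int" where
  "frobenius S = (GREATEST x. x \<notin> S)"

definition pseudo_frobenius :: "int set \<Rightarrow> int set" where
  "pseudo_frobenius S = {x. x \<notin> S \<and> (\<forall>s\<in>S - {0}. x + s \<in> S)}"

definition Delta_H :: "int set \<Rightarrow> int set" where
  "Delta_H S = {h. h \<notin> S \<and> frobenius S - h \<notin> S}"

definition almost_symmetric :: "int set \<Rightarrow> bool" where
  "almost_symmetric S \<longleftrightarrow> pseudo_frobenius S - {frobenius S} = Delta_H S"


section \<open>Minimal graded free resolutions\<close>

text \<open>Polynomials in variables indexed by the natural numbers; a monomial is its
  exponent vector. The ring $k[X_1,\dots,X_m]$ is the subset \<open>poly_ring m\<close>.\<close>

type_synonym 'k mpolynomial = "(nat \<Rightarrow>\<^sub>0 nat) \<Rightarrow>\<^sub>0 'k"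

definition poly_ring :: "nat \<Rightarrow> 'k::field mpolynomial set" where
  "poly_ring m = {p. \<forall>a\<in>Poly_Mapping.keys p. Poly_Mapping.keys a \<subseteq> {1..m}}"

definition wdegree :: "nat \<Rightarrow> (nat \<Rightarrow> nat) \<Rightarrow> (nat \<Rightarrow>\<^sub>0 nat) \<Rightarrow> nat" where
  "wdegree m d a = (\<Sum>i=1..m. Poly_Mapping.lookup a i * d i)"

text \<open>The $k$-algebra homomorphism $X_i \mapsto z^{d_i}$. Its image is
  $k[z^{d_1},\dots,z^{d_m}]$, so it is the augmentation of a resolution of that module.\<close>

definition augmentation :: "nat \<Rightarrow> (nat \<Rightarrow> nat) \<Rightarrow> 'k::field mpolynomial \<Rightarrow> 'k poly" where
  "augmentation m d p =
     (\<Sum>a\<in>Poly_Mapping.keys p. smult (Poly_Mapping.lookup p a)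
        (\<Prod>i=1..m. (monom 1 (d i)) ^ Poly_Mapping.lookup a i))"

text \<open>The free module of rank \<open>b\<close> over \<open>poly_ring m\<close>; vectors vanish outside \<open>{1..b}\<close>,
  so that equality of vectors is equality of functions.\<close>

definition free_module :: "nat \<Rightarrow> nat \<Rightarrow> (nat \<Rightarrow> 'k::field mpolynomial) set" where
  "free_module m b = {v. (\<forall>j\<in>{1..b}. v j \<in> poly_ring m) \<and> (\<forall>j. j \<notin> {1..b} \<longrightarrow> v j = 0)}"

definition mat_apply ::
  "nat \<Rightarrow> nat \<Rightarrow> (nat \<Rightarrow> nat \<Rightarrow> 'k::field mpolynomial) \<Rightarrow> (nat \<Rightarrow> 'k mpolynomial) \<Rightarrow> nat \<Rightarrow> 'k mpolynomial"
where
  "mat_apply a b M v = (\<lambda>r. if r \<in> {1..a} then \<Sum>j=1..b. M r j * v j else 0)"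

text \<open>\<open>graded_free_resolution m d L \<beta> C A\<close>: the matrices \<open>A i\<close> are the differentials
  $F_i \to F_{i-1}$ of a graded free resolution
  $0 \to F_L \to \dots \to F_1 \to F_0 \to k[z^{d_1},\dots,z^{d_m}] \to 0$
  over $R = k[X_1,\dots,X_m]$, where $F_i$ has rank \<open>\<beta> i\<close> with basis elements of degrees
  \<open>C 1 i, \<dots>, C (\<beta> i) i\<close>, and $F_0 = R$. The differentials preserve degrees,
  hence the \<open>(r, j)\<close> entry of \<open>A i\<close> is zero or homogeneous of degree \<open>C j i - C r (i - 1)\<close>.
  The last three clauses are exactness at $F_0$, at $F_1, \dots, F_{L-1}$ and at $F_L$.\<close>

definition graded_free_resolution ::
  "nat \<Rightarrow> (nat \<Rightarrow> nat) \<Rightarrow> nat \<Rightarrow> (nat \<Rightarrow> nat) \<Rightarrow> (nat \<Rightarrow> nat \<Rightarrow> nat) \<Rightarrow>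
   (nat \<Rightarrow> nat \<Rightarrow> nat \<Rightarrow> 'k::field mpolynomial) \<Rightarrow> bool"
where
  "graded_free_resolution m d L \<beta> C A \<longleftrightarrow>
     1 \<le> L \<and> \<beta> 0 = 1 \<and> C 1 0 = 0 \<and>
     (\<forall>i\<in>{1..L}. \<forall>r\<in>{1..\<beta> (i - 1)}. \<forall>j\<in>{1..\<beta> i}.
        A i r j \<in> poly_ring m \<and>
        (\<forall>a\<in>Poly_Mapping.keys (A i r j). wdegree m d a + C r (i - 1) = C j i)) \<and>
     mat_apply (\<beta> 0) (\<beta> 1) (A 1) ` free_module m (\<beta> 1) =
       {v \<in> free_module m (\<beta> 0). augmentation m d (v 1) = 0} \<and>
     (\<forall>i\<in>{1..<L}.
        mat_apply (\<beta> i) (\<beta> (i + 1)) (A (i + 1)) ` free_module m (\<beta> (i + 1)) =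
        {v \<in> free_module m (\<beta> i). mat_apply (\<beta> (i - 1)) (\<beta> i) (A i) v = (\<lambda>_. 0)}) \<and>
     {v \<in> free_module m (\<beta> L). mat_apply (\<beta> (L - 1)) (\<beta> L) (A L) v = (\<lambda>_. 0)} = {\<lambda>_. 0}"

text \<open>A graded free resolution is minimal if every differential maps $F_i$ into
  $(X_1,\dots,X_m) F_{i-1}$, that is, no matrix entry has a constant term.\<close>

definition minimal_graded_free_resolution ::
  "nat \<Rightarrow> (nat \<Rightarrow> nat) \<Rightarrow> nat \<Rightarrow> (nat \<Rightarrow> nat) \<Rightarrow> (nat \<Rightarrow> nat \<Rightarrow> nat) \<Rightarrow>
   (nat \<Rightarrow> nat \<Rightarrow> nat \<Rightarrow> 'k::field mpolynomial) \<Rightarrow> bool"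
where
  "minimal_graded_free_resolution m d L \<beta> C A \<longleftrightarrow>
     graded_free_resolution m d L \<beta> C A \<and>
     (\<forall>i\<in>{1..L}. \<forall>r\<in>{1..\<beta> (i - 1)}. \<forall>j\<in>{1..\<beta> i}. Poly_Mapping.lookup (A i r j) 0 = 0)"

definition syzygy_requirements :: "nat \<Rightarrow> (nat \<Rightarrow> nat) \<Rightarrow> (nat \<Rightarrow> nat \<Rightarrow> nat) \<Rightarrow> bool" where
  "syzygy_requirements m \<beta> C \<longleftrightarrow>
     (\<forall>i\<in>{1..m - 1}. \<forall>j\<in>{1..\<beta> i}. 0 < C j i) \<and>
     (\<forall>i\<in>{1..m - 1}. \<forall>j\<in>{1..<\<beta> i}. C j i \<le> C (j + 1) i) \<and>
     (\<forall>i\<in>{1..<m - 1}. C (\<beta> i) i < C (\<beta> (i + 1)) (i + 1)) \<and>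
     (\<forall>i\<in>{1..<m - 1}. C 1 i < C 1 (i + 1)) \<and>
     (\<forall>i\<in>{1..m - 1}. \<forall>k\<in>{1..(m - i) div 2}. \<forall>j\<in>{1..\<beta> i}. \<forall>r\<in>{1..\<beta> (i + 2 * k - 1)}.
        C j i \<noteq> C r (i + 2 * k - 1))"


section \<open>The multisets\<close>

definition L_mset :: "nat \<Rightarrow> (nat \<Rightarrow> nat) \<Rightarrow> nat \<Rightarrow> int multiset" where
  "L_mset m d i =
     image_mset (\<lambda>(I, h). int (\<Sum>j\<in>I. d j) + h)
       (mset_set ({I. I \<subseteq> {1..m} \<and> card I = i} \<times> Delta_H (semigroup_of m d)))"

definition L_odd :: "nat \<Rightarrow> (nat \<Rightarrow> nat) \<Rightarrow> int multiset" where
  "L_odd m d = (\<Sum>i\<in>{i\<in>{1..m - 1}. odd i}. L_mset m d i)"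

definition L_even :: "nat \<Rightarrow> (nat \<Rightarrow> nat) \<Rightarrow> int multiset" where
  "L_even m d = (\<Sum>i\<in>{i\<in>{1..m - 1}. even i}. L_mset m d i)"

definition B_mset :: "(nat \<Rightarrow> nat) \<Rightarrow> (nat \<Rightarrow> nat \<Rightarrow> nat) \<Rightarrow> nat \<Rightarrow> int multiset" where
  "B_mset \<beta> C i = image_mset (\<lambda>j. int (C j i)) (mset_set {1..\<beta> i})"

definition Bbar_mset ::
  "nat \<Rightarrow> (nat \<Rightarrow> nat) \<Rightarrow> (nat \<Rightarrow> nat) \<Rightarrow> (nat \<Rightarrow> nat \<Rightarrow> nat) \<Rightarrow> nat \<Rightarrow> int multiset"
where
  "Bbar_mset m d \<beta> C i =
     image_mset (\<lambda>j. frobenius (semigroup_of m d) + int (\<Sum>k=1..m. d k) - int (C j i))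
       (mset_set {1..\<beta> i})"

text \<open>For $m = 2n + 1$ generators; the last syzygies, those of step $2n$, are left out of
  the even joins.\<close>

definition B_odd :: "nat \<Rightarrow> (nat \<Rightarrow> nat) \<Rightarrow> (nat \<Rightarrow> nat \<Rightarrow> nat) \<Rightarrow> int multiset" where
  "B_odd n \<beta> C = (\<Sum>i=1..n. B_mset \<beta> C (2 * i - 1))"

definition B_even :: "nat \<Rightarrow> (nat \<Rightarrow> nat) \<Rightarrow> (nat \<Rightarrow> nat \<Rightarrow> nat) \<Rightarrow> int multiset" where
  "B_even n \<beta> C = (\<Sum>i=1..n - 1. B_mset \<beta> C (2 * i))"

definition Bbar_odd ::
  "nat \<Rightarrow> (nat \<Rightarrow> nat) \<Rightarrow> (nat \<Rightarrow> nat) \<Rightarrow> (nat \<Rightarrow> nat \<Rightarrow> nat) \<Rightarrow> int multiset"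
where
  "Bbar_odd n d \<beta> C = (\<Sum>i=1..n. Bbar_mset (2 * n + 1) d \<beta> C (2 * i - 1))"

definition Bbar_even ::
  "nat \<Rightarrow> (nat \<Rightarrow> nat) \<Rightarrow> (nat \<Rightarrow> nat) \<Rightarrow> (nat \<Rightarrow> nat \<Rightarrow> nat) \<Rightarrow> int multiset"
where
  "Bbar_even n d \<beta> C = (\<Sum>i=1..n - 1. Bbar_mset (2 * n + 1) d \<beta> C (2 * i))"

end

theory Submission
  imports Defs "HOL-Library.Function_Algebras"
begin

text \<open>Let $H$ be the Hilbert series of $k[S]$, $P = \prod_{t=1}^m (1 - z^{d_t})$ and $Q = PH$. By exactness
  of the resolution in each degree, $Q$ is the alternating sum of the $Q_i$. The set
  $\{x : F - x \notin S\}$ is the disjoint union of $S$ and $\Delta_{\mathcal H}$, which for odd $m$ gives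
  $z^{F + \Sigma_m} Q(1/z) = Q(z) + P(z) \sum_{h \in \Delta_{\mathcal H}} z^h$; expanding $P$ turns the last
  product into the multisets $\mathfrak L_i$. The two equations of the theorem together say that
  $[\mathfrak B_o \bigvee \overline{\mathfrak B}_e] \bigvee \mathfrak L_o =
  [\mathfrak B_e \bigvee \overline{\mathfrak B}_o] \bigvee \mathfrak L_e$, and this follows once $Q_{m-1}$
  is known: the degrees of the last syzygies are the numbers $x + \Sigma_m$ with $x$ a pseudo-Frobenius
  number, that is, $x = F$ or $x \in \Delta_{\mathcal H}$ by almost symmetry.

  The last syzygies are found by setting the variables to zero one at a time: if a minimal complex of length
  $r$ over $k[x_1, \dots, x_r]$ resolves $N = F_0/Z$, its truncation modulo $x_r$ resolves $Z/x_r Z$, whose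
  socle is that of $N$ shifted by $d_r$; for $r = 0$ the socle is $F_0$ itself.\<close>

section \<open>Filtering polynomials by monomials\<close>

text \<open>\<open>B_even\<close> and \<open>Bbar_even\<close> omit step 2n = m - 1, and
  \<open>L_even\<close>, \<open>L_odd\<close> omit the subsets of size 0 and m. Comparing Q with its
  reflection leaves exactly these end terms, and they match because the last syzygy degrees are
  known with multiplicity: each pseudo-Frobenius number counts once.

  The resolution has length m - 1 over m variables, while the induction wants equality. Reducing
  modulo X_m with F_0 kept repairs this, since z^(d_m) is regular on k[S]. In the later reductions
  x_r need not be regular on N = F_0/Z; but Z lies in a free module, so every variable is regular on
  it, which is why F_0 is dropped. A socle element of Z/x_r Z becomes zero in F_0/x_r F_0, hence has
  the form x_r f: another variable can be cancelled there as long as one is left, and minimality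
  takes over when none is.

  Reflecting z to 1/z makes the series of S infinite in the other direction. The reflected set, S
  and \<open>Delta_H\<close> together fill all the integers, and the series over all integers is
  annihilated by P; so P acts here as an operator on arbitrary functions on the integers.\<close>

abbreviation lookup :: "('a \<Rightarrow>\<^sub>0 'b::zero) \<Rightarrow> 'a \<Rightarrow> 'b" where
  "lookup \<equiv> Poly_Mapping.lookup"

abbreviation keys :: "('a \<Rightarrow>\<^sub>0 'b::zero) \<Rightarrow> 'a set" where
  "keys \<equiv> Poly_Mapping.keys"

definition pfilter :: "('a \<Rightarrow> bool) \<Rightarrow> ('a \<Rightarrow>\<^sub>0 'b) \<Rightarrow> ('a \<Rightarrow>\<^sub>0 'b::zero)" where
  "pfilter P p = Poly_Mapping.mapp (\<lambda>a x. x when P a) p"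

lemma lookup_pfilter: "lookup (pfilter P p) a = (lookup p a when P a)"
  by (auto simp: pfilter_def lookup_mapp when_def in_keys_iff)

lemma keys_pfilter: "keys (pfilter P p) = {a \<in> keys p. P a}"
  by (auto simp: in_keys_iff lookup_pfilter when_def split: if_splits)

lemma pfilter_add: "pfilter P (p + q) = pfilter P p + pfilter P q"
  for p q :: "'a \<Rightarrow>\<^sub>0 'b::monoid_add"
  by (rule poly_mapping_eqI) (simp add: lookup_pfilter lookup_add when_def)

lemma pfilter_diff: "pfilter P (p - q) = pfilter P p - pfilter P q"
  for p q :: "'a \<Rightarrow>\<^sub>0 'b::cancel_comm_monoid_add"
  by (rule poly_mapping_eqI) (simp add: lookup_pfilter lookup_minus when_def)

lemma pfilter_zero [simp]: "pfilter P 0 = 0"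
  by (rule poly_mapping_eqI) (simp add: lookup_pfilter)

lemma pfilter_sum: "pfilter P (\<Sum>i\<in>I. f i) = (\<Sum>i\<in>I. pfilter P (f i))"
  for f :: "'c \<Rightarrow> 'a \<Rightarrow>\<^sub>0 'b::comm_monoid_add"
  by (induction I rule: infinite_finite_induct) (simp_all add: pfilter_add)

lemma pfilter_id: "(\<And>a. a \<in> keys p \<Longrightarrow> P a) \<Longrightarrow> pfilter P p = p"
  by (rule poly_mapping_eqI) (auto simp: lookup_pfilter when_def in_keys_iff)

lemma pfilter_eq_zero: "(\<And>a. a \<in> keys p \<Longrightarrow> \<not> P a) \<Longrightarrow> pfilter P p = 0"
  by (rule poly_mapping_eqI) (auto simp: lookup_pfilter when_def in_keys_iff)

lemma pfilter_split: "p = pfilter P p + pfilter (\<lambda>a. \<not> P a) p"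
  for p :: "'a \<Rightarrow>\<^sub>0 'b::monoid_add"
  by (rule poly_mapping_eqI) (simp add: lookup_pfilter lookup_add when_def)

text \<open>Splitting \<open>q\<close> by \<open>Q\<close> makes every monomial of the first product
  satisfy \<open>P\<close> and none of the second. Two instances matter: a factor free of X_t when
  that variable is set to zero, and a homogeneous matrix entry when a degree is selected.\<close>

lemma pfilter_mult:
  fixes p q :: "'a::monoid_add \<Rightarrow>\<^sub>0 'b::semiring_0"
  assumes "\<And>a b. a \<in> keys p \<Longrightarrow> b \<in> keys q \<Longrightarrow> P (a + b) \<longleftrightarrow> Q b"
  shows "pfilter P (p * q) = p * pfilter Q q"
proof -
  have "pfilter P (p * pfilter Q q) = p * pfilter Q q"
    using assms keys_mult[of p "pfilter Q q"] by (intro pfilter_id) (force simp: keys_pfilter)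
  moreover have "pfilter P (p * pfilter (\<lambda>a. \<not> Q a) q) = 0"
    using assms keys_mult[of p "pfilter (\<lambda>a. \<not> Q a) q"]
    by (intro pfilter_eq_zero) (force simp: keys_pfilter)
  ultimately show ?thesis
    by (subst pfilter_split[of q Q]) (simp add: distrib_left pfilter_add)
qed

lemma lookup_single_mult:
  "lookup (Poly_Mapping.single s c * q) (s + b) = c * lookup q b"
  for q :: "'a::cancel_comm_monoid_add \<Rightarrow>\<^sub>0 'b::semiring_0"
  by (simp add: lookup_mult lookup_single when_mult)

section \<open>Setting a variable to zero and dividing by it\<close>

definition Var :: "nat \<Rightarrow> 'k::field mpolynomial" where
  "Var t = Poly_Mapping.single (Poly_Mapping.single t 1) 1"

text \<open>The quotient by X_t is realised inside the same type, as the polynomials free of that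
  variable; so reduction modulo X_(r+1) leads from \<open>poly_ring (Suc r)\<close> to its subset
  \<open>poly_ring r\<close>.\<close>

definition setzero :: "nat \<Rightarrow> 'k::field mpolynomial \<Rightarrow> 'k mpolynomial" where
  "setzero t = pfilter (\<lambda>a. lookup a t = 0)"

text \<open>Shifting exponents discards the monomials not divisible by X_t. It is a left inverse of
  multiplication by X_t, which is what makes variables cancellable.\<close>

definition divVar :: "nat \<Rightarrow> 'k::field mpolynomial \<Rightarrow> 'k mpolynomial" where
  "divVar t = Poly_Mapping.map_key (\<lambda>a. Poly_Mapping.single t 1 + a)"

lemma lookup_divVar: "lookup (divVar t p) a = lookup p (Poly_Mapping.single t 1 + a)"
  unfolding divVar_def by (subst map_key.rep_eq) (auto simp: inj_on_def)

lemma lookup_Var_mult: "lookup (Var t * q) (Poly_Mapping.single t 1 + a) = lookup q a"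
  unfolding Var_def by (simp add: lookup_single_mult)

lemma divVar_Var_mult [simp]: "divVar t (Var t * p) = p"
  by (rule poly_mapping_eqI) (simp only: lookup_divVar lookup_Var_mult)

lemma keys_Var: "keys (Var t :: 'k::field mpolynomial) = {Poly_Mapping.single t 1}"
  by (simp add: Var_def)

lemma monomial_split: "0 < lookup a t \<Longrightarrow> \<exists>b. a = Poly_Mapping.single t (1::nat) + b"
  by (rule exI[of _ "a - Poly_Mapping.single t 1"], rule poly_mapping_eqI)
     (auto simp: lookup_add lookup_minus lookup_single when_def)

lemma setzero_split: "p = setzero t p + Var t * divVar t p"
proof (rule poly_mapping_eqI)
  fix a
  show "lookup p a = lookup (setzero t p + Var t * divVar t p) a"
  proof (cases "lookup a t = 0")
    case True
    then have "a \<notin> keys (Var t * divVar t p)"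
      using keys_mult[of "Var t" "divVar t p"] by (auto simp: keys_Var lookup_add)
    then show ?thesis
      using True by (simp add: lookup_add setzero_def lookup_pfilter in_keys_iff)
  next
    case False
    then obtain b where a: "a = Poly_Mapping.single t 1 + b"
      using monomial_split[of a t] by auto
    then show ?thesis
      unfolding a lookup_add[of "setzero t p"] lookup_Var_mult lookup_divVar
      by (simp add: setzero_def lookup_pfilter lookup_add)
  qed
qed

lemma setzero_Var_mult [simp]: "setzero t (Var t * p) = 0"
  unfolding setzero_def using keys_mult[of "Var t" p]
  by (intro pfilter_eq_zero) (auto simp: keys_Var lookup_add)

lemma setzero_zero [simp]: "setzero t 0 = 0"
  by (simp add: setzero_def)

lemma setzero_add: "setzero t (p + q) = setzero t p + setzero t q"
  and setzero_diff: "setzero t (p - q) = setzero t p - setzero t q"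
  by (simp_all add: setzero_def pfilter_add pfilter_diff)

lemma setzero_sum: "setzero t (\<Sum>i\<in>I. f i) = (\<Sum>i\<in>I. setzero t (f i))"
  by (simp add: setzero_def pfilter_sum)

lemma divVar_zero [simp]: "divVar t 0 = 0"
  by (rule poly_mapping_eqI) (simp add: lookup_divVar)

lemma setzero_mult: "setzero t (p * q) = setzero t p * setzero t q"
proof -
  have "setzero t (setzero t p * q) = setzero t p * setzero t q"
    unfolding setzero_def by (rule pfilter_mult) (auto simp: keys_pfilter lookup_add)
  moreover have "setzero t (Var t * divVar t p * q) = 0"
    by (simp add: mult.assoc)
  ultimately show ?thesis
    by (subst setzero_split[of p t]) (simp add: distrib_right setzero_def pfilter_add)
qed

lemma setzero_Var: "s \<noteq> t \<Longrightarrow> setzero t (Var s) = Var s"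
  unfolding setzero_def by (rule pfilter_id) (auto simp: keys_Var lookup_single)


section \<open>Free modules\<close>

lemma keys_minus_subset: "keys (p - q) \<subseteq> keys p \<union> keys q"
  for p q :: "'a \<Rightarrow>\<^sub>0 'b::cancel_comm_monoid_add"
  by (auto simp: in_keys_iff lookup_minus)

lemma poly_ring_add: "p \<in> poly_ring r \<Longrightarrow> q \<in> poly_ring r \<Longrightarrow> p + q \<in> poly_ring r"
  using keys_add[of p q] by (fastforce simp: poly_ring_def)

lemma poly_ring_diff: "p \<in> poly_ring r \<Longrightarrow> q \<in> poly_ring r \<Longrightarrow> p - q \<in> poly_ring r"
  using keys_minus_subset[of p q] by (fastforce simp: poly_ring_def)

lemma poly_ring_zero [simp]: "0 \<in> poly_ring r"
  by (simp add: poly_ring_def)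

lemma poly_ring_mult:
  assumes "p \<in> poly_ring r" "q \<in> poly_ring r" shows "p * q \<in> poly_ring r"
proof -
  have "keys (a + b) \<subseteq> {1..r}" if "a \<in> keys p" "b \<in> keys q" for a b
    using that assms keys_add[of a b] by (fastforce simp: poly_ring_def)
  then show ?thesis
    using keys_mult[of p q] by (fastforce simp: poly_ring_def)
qed

lemma poly_ring_sum: "(\<And>i. i \<in> I \<Longrightarrow> f i \<in> poly_ring r) \<Longrightarrow> (\<Sum>i\<in>I. f i) \<in> poly_ring r"
  by (induction I rule: infinite_finite_induct) (auto intro: poly_ring_add)

lemma poly_ring_single: "keys a \<subseteq> {1..r} \<Longrightarrow> Poly_Mapping.single a c \<in> poly_ring r"
  by (simp add: poly_ring_def)

lemma poly_ring_Var: "t \<in> {1..r} \<Longrightarrow> Var t \<in> poly_ring r"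
  unfolding Var_def by (rule poly_ring_single) simp

lemma poly_ring_mono: "r \<le> s \<Longrightarrow> poly_ring r \<subseteq> poly_ring s"
  by (fastforce simp: poly_ring_def)

lemma poly_ring_pfilter: "p \<in> poly_ring r \<Longrightarrow> pfilter P p \<in> poly_ring r"
  by (auto simp: poly_ring_def keys_pfilter)

lemma poly_ring_setzero:
  assumes "p \<in> poly_ring (Suc r)" shows "setzero (Suc r) p \<in> poly_ring r"
proof -
  have "keys a \<subseteq> {1..r}" if "a \<in> keys p" "lookup a (Suc r) = 0" for a
  proof
    fix x assume "x \<in> keys a"
    then have "x \<in> {1..Suc r}"
      using that(1) assms unfolding poly_ring_def by blast
    moreover have "x \<noteq> Suc r"
      using \<open>x \<in> keys a\<close> that(2) by (auto simp: in_keys_iff)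
    ultimately show "x \<in> {1..r}" by simp
  qed
  then show ?thesis
    by (simp add: poly_ring_def setzero_def keys_pfilter)
qed

lemma setzero_id: "p \<in> poly_ring r \<Longrightarrow> setzero (Suc r) p = p"
  unfolding setzero_def by (rule pfilter_id) (fastforce simp: poly_ring_def in_keys_iff)

lemma poly_ring_divVar:
  assumes "p \<in> poly_ring r" shows "divVar t p \<in> poly_ring r"
proof -
  have "keys a \<subseteq> keys (Poly_Mapping.single t 1 + a)" for a :: "nat \<Rightarrow>\<^sub>0 nat"
    by (auto simp: in_keys_iff lookup_add)
  moreover have "Poly_Mapping.single t 1 + a \<in> keys p" if "a \<in> keys (divVar t p)" for a
    using that by (simp only: in_keys_iff lookup_divVar not_False_eq_True)
  ultimately show ?thesis
    using assms unfolding poly_ring_def by blast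
qed

definition vmul :: "'k::field mpolynomial \<Rightarrow> (nat \<Rightarrow> 'k mpolynomial) \<Rightarrow> nat \<Rightarrow> 'k mpolynomial" where
  "vmul p v = (\<lambda>j. p * v j)"

definition vsetzero :: "nat \<Rightarrow> (nat \<Rightarrow> 'k::field mpolynomial) \<Rightarrow> nat \<Rightarrow> 'k mpolynomial" where
  "vsetzero t v = (\<lambda>j. setzero t (v j))"

lemma sum_fun_apply: "(\<Sum>i\<in>I. f i) x = (\<Sum>i\<in>I. f i x)"
  by (induction I rule: infinite_finite_induct) auto

lemma vmul_add: "vmul p (v + w) = vmul p v + vmul p w"
  and vmul_diff: "vmul p (v - w) = vmul p v - vmul p w"
  and vmul_vmul: "vmul p (vmul q v) = vmul (p * q) v"
  and vmul_zero [simp]: "vmul p 0 = 0"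
  and vmul_sum: "vmul p (\<Sum>i\<in>I. f i) = (\<Sum>i\<in>I. vmul p (f i))"
  by (auto simp: vmul_def fun_eq_iff algebra_simps sum_fun_apply sum_distrib_left)

lemma vmul_commute: "vmul p (vmul q v) = vmul q (vmul p v)"
  by (simp add: vmul_vmul mult.commute)

lemma vsetzero_diff: "vsetzero t (v - w) = vsetzero t v - vsetzero t w"
  and vsetzero_vmul: "vsetzero t (vmul p v) = vmul (setzero t p) (vsetzero t v)"
  and vsetzero_Var [simp]: "vsetzero t (vmul (Var t) v) = 0"
  and vsetzero_zero [simp]: "vsetzero t 0 = 0"
  by (simp_all add: vsetzero_def vmul_def fun_eq_iff setzero_mult[of t p] setzero_add setzero_diff)

lemma vmul_Var_cancel: "vmul (Var t) v = vmul (Var t) w \<Longrightarrow> v = w"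
  by (metis (no_types, lifting) divVar_Var_mult ext vmul_def)

lemma free_module_zero [simp]: "0 \<in> free_module r b"
  by (simp add: free_module_def)

lemma free_module_rank_zero: "free_module r 0 = {0}"
  by (auto simp: free_module_def)

lemma free_module_add: "v \<in> free_module r b \<Longrightarrow> w \<in> free_module r b \<Longrightarrow> v + w \<in> free_module r b"
  and free_module_diff: "v \<in> free_module r b \<Longrightarrow> w \<in> free_module r b \<Longrightarrow> v - w \<in> free_module r b"
  and free_module_vmul: "p \<in> poly_ring r \<Longrightarrow> v \<in> free_module r b \<Longrightarrow> vmul p v \<in> free_module r b"
  by (auto simp: free_module_def vmul_def intro: poly_ring_add poly_ring_diff poly_ring_mult)

lemma free_module_sum:
  "(\<And>i. i \<in> I \<Longrightarrow> f i \<in> free_module r b) \<Longrightarrow> (\<Sum>i\<in>I. f i) \<in> free_module r b"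
  by (induction I rule: infinite_finite_induct) (auto intro: free_module_add)

lemma free_module_mono: "r \<le> s \<Longrightarrow> free_module r b \<subseteq> free_module s b"
  using poly_ring_mono[of r s] by (auto simp: free_module_def)

lemma free_module_vsetzero:
  "v \<in> free_module (Suc r) b \<Longrightarrow> vsetzero (Suc r) v \<in> free_module r b"
  by (auto simp: free_module_def vsetzero_def poly_ring_setzero)

lemma vsetzero_id: "v \<in> free_module r b \<Longrightarrow> vsetzero (Suc r) v = v"
  unfolding free_module_def vsetzero_def fun_eq_iff
  by (metis (mono_tags, lifting) mem_Collect_eq poly_ring_zero setzero_id)

lemma vsetzero_split:
  assumes "v \<in> free_module r b"
  obtains w where "w \<in> free_module r b" "v = vsetzero t v + vmul (Var t) w"
proof
  show "(\<lambda>j. divVar t (v j)) \<in> free_module r b"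
    using assms by (auto simp: free_module_def poly_ring_divVar)
  show "v = vsetzero t v + vmul (Var t) (\<lambda>j. divVar t (v j))"
    using setzero_split by (auto simp: vsetzero_def vmul_def fun_eq_iff)
qed

lemma mat_apply_add: "mat_apply a b M (v + w) = mat_apply a b M v + mat_apply a b M w"
  and mat_apply_diff: "mat_apply a b M (v - w) = mat_apply a b M v - mat_apply a b M w"
  and mat_apply_vmul: "mat_apply a b M (vmul p v) = vmul p (mat_apply a b M v)"
  and mat_apply_zero [simp]: "mat_apply a b M 0 = 0"
  by (auto simp: mat_apply_def vmul_def fun_eq_iff algebra_simps sum.distrib sum_subtractf sum_distrib_left)

lemma mat_apply_sum: "mat_apply a b M (\<Sum>i\<in>I. f i) = (\<Sum>i\<in>I. mat_apply a b M (f i))"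
  using sum_comp_morphism[of "mat_apply a b M" f I] by (simp only: mat_apply_zero mat_apply_add comp_def)

lemma mat_apply_vsetzero:
  "mat_apply a b (\<lambda>p j. setzero t (M p j)) (vsetzero t v) = vsetzero t (mat_apply a b M v)"
  by (auto simp: mat_apply_def vsetzero_def fun_eq_iff setzero_mult setzero_sum)

lemma mat_apply_in_free_module:
  assumes "\<And>p j. p \<in> {1..a} \<Longrightarrow> j \<in> {1..b} \<Longrightarrow> M p j \<in> poly_ring r" "v \<in> free_module r b"
  shows "mat_apply a b M v \<in> free_module r a"
  using assms by (auto simp: free_module_def mat_apply_def intro!: poly_ring_sum poly_ring_mult)


section \<open>Complexes modulo a variable\<close>

definition msetzero :: "nat \<Rightarrow> (nat \<Rightarrow> nat \<Rightarrow> 'k::field mpolynomial) \<Rightarrow> nat \<Rightarrow> nat \<Rightarrow> 'k mpolynomial" where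
  "msetzero t M = (\<lambda>p j. setzero t (M p j))"

definition Const :: "'k \<Rightarrow> 'k::field mpolynomial" where
  "Const c = Poly_Mapping.single 0 c"

lemma poly_ring_Const [simp]: "Const c \<in> poly_ring r"
  unfolding Const_def by (rule poly_ring_single) simp

lemma setzero_Const [simp]: "setzero t (Const c) = Const c"
  unfolding setzero_def Const_def by (rule pfilter_id) (auto split: if_splits)

text \<open>By exactness \<open>M\<close> embeds the cokernel of \<open>N\<close> into a free
  module, where a variable can be cancelled. This gives regularity on the cokernel of every
  differential above \<open>A 1\<close>.\<close>

lemma regular_on_cokernel:
  fixes M :: "nat \<Rightarrow> nat \<Rightarrow> 'k::field mpolynomial"
  assumes ex: "{v \<in> free_module r b. mat_apply a b M v = 0} = mat_apply b c N ` free_module r c"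
    and "w \<in> free_module r b" "vmul (Var t) w \<in> mat_apply b c N ` free_module r c"
  shows "w \<in> mat_apply b c N ` free_module r c"
proof -
  have "vmul (Var t) (mat_apply a b M w) = vmul (Var t) 0"
    using assms(3) unfolding ex[symmetric] by (simp add: mat_apply_vmul)
  then have "mat_apply a b M w = 0"
    by (rule vmul_Var_cancel)
  then show ?thesis
    using ex assms(2) by blast
qed

text \<open>The homology of the reduced complex at the middle term is Tor_1 of the cokernel of
  \<open>M\<close> against the quotient by the variable; \<open>reg\<close> is its
  vanishing.\<close>

lemma exact_setzero:
  fixes M N :: "nat \<Rightarrow> nat \<Rightarrow> 'k::field mpolynomial"
  assumes M: "\<And>p j. p \<in> {1..a} \<Longrightarrow> j \<in> {1..b} \<Longrightarrow> M p j \<in> poly_ring (Suc r)"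
    and ex: "{v \<in> free_module (Suc r) b. mat_apply a b M v = 0} = mat_apply b c N ` free_module (Suc r) c"
    and reg: "\<And>w. w \<in> free_module (Suc r) a \<Longrightarrow>
      vmul (Var (Suc r)) w \<in> mat_apply a b M ` free_module (Suc r) b \<Longrightarrow>
      w \<in> mat_apply a b M ` free_module (Suc r) b"
  shows "{v \<in> free_module r b. mat_apply a b (msetzero (Suc r) M) v = 0} =
    mat_apply b c (msetzero (Suc r) N) ` free_module r c" (is "?K = ?I")
proof
  have sub: "free_module r x \<subseteq> (free_module (Suc r) x :: (nat \<Rightarrow> 'k mpolynomial) set)" for x
    by (rule free_module_mono) simp
  show "?I \<subseteq> ?K"
  proof
    fix y assume "y \<in> ?I"
    then obtain u where u: "u \<in> free_module r c" "y = mat_apply b c (msetzero (Suc r) N) u" by auto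
    then have y: "y = vsetzero (Suc r) (mat_apply b c N u)"
      using mat_apply_vsetzero[of b c "Suc r" N u] by (simp add: vsetzero_id msetzero_def)
    have Nu: "mat_apply b c N u \<in> free_module (Suc r) b" "mat_apply a b M (mat_apply b c N u) = 0"
      using u(1) sub ex by blast+
    then show "y \<in> ?K"
      using y mat_apply_vsetzero[of a b "Suc r" M "mat_apply b c N u"]
      by (auto simp: msetzero_def free_module_vsetzero)
  qed
  show "?K \<subseteq> ?I"
  proof
    fix v assume "v \<in> ?K"
    then have v: "v \<in> free_module r b" "mat_apply a b (msetzero (Suc r) M) v = 0" by auto
    then have v': "v \<in> free_module (Suc r) b" using sub by blast
    have "vsetzero (Suc r) (mat_apply a b M v) = 0"
      using mat_apply_vsetzero[of a b "Suc r" M v] v by (simp add: vsetzero_id msetzero_def)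
    moreover obtain w where w: "w \<in> free_module (Suc r) a"
        "mat_apply a b M v = vsetzero (Suc r) (mat_apply a b M v) + vmul (Var (Suc r)) w"
      using vsetzero_split[OF mat_apply_in_free_module[of a b M, OF M v']] by metis
    ultimately have Mv: "mat_apply a b M v = vmul (Var (Suc r)) w" by simp
    then have "w \<in> mat_apply a b M ` free_module (Suc r) b"
      using reg[OF w(1)] v' by (metis imageI)
    then obtain v1 where v1: "v1 \<in> free_module (Suc r) b" "w = mat_apply a b M v1" by auto
    \<comment> \<open>A lift of \<open>v\<close> to the kernel of \<open>M\<close> arises by
      subtracting a multiple of the variable, which the final reduction does not see.\<close>
    have "v - vmul (Var (Suc r)) v1 \<in> free_module (Suc r) b"
      using v' v1 by (auto intro!: free_module_diff free_module_vmul poly_ring_Var)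
    moreover have "mat_apply a b M (v - vmul (Var (Suc r)) v1) = 0"
      by (simp add: mat_apply_diff mat_apply_vmul Mv v1)
    ultimately obtain u where u: "u \<in> free_module (Suc r) c" "v - vmul (Var (Suc r)) v1 = mat_apply b c N u"
      using ex by blast
    have "v = vsetzero (Suc r) (v - vmul (Var (Suc r)) v1)"
      using v(1) by (simp add: vsetzero_diff vsetzero_id)
    also have "\<dots> = mat_apply b c (msetzero (Suc r) N) (vsetzero (Suc r) u)"
      using mat_apply_vsetzero[of b c "Suc r" N u] u(2) by (simp add: msetzero_def)
    finally show "v \<in> ?I"
      using free_module_vsetzero[OF u(1)] by blast
  qed
qed

text \<open>The exactness clause at \<open>L\<close> together with \<open>\<beta> (Suc L) = 0\<close> expresses injectivity of the
  last differential. Nothing is required at $F_0$, so the complex resolves the cokernel of \<open>A 1\<close>.\<close>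

definition minimal_complex ::
  "nat \<Rightarrow> (nat \<Rightarrow> nat) \<Rightarrow> nat \<Rightarrow> nat \<Rightarrow> (nat \<Rightarrow> nat) \<Rightarrow> (nat \<Rightarrow> nat \<Rightarrow> nat) \<Rightarrow>
   (nat \<Rightarrow> nat \<Rightarrow> nat \<Rightarrow> 'k::field mpolynomial) \<Rightarrow> bool"
where
  "minimal_complex m d r L \<beta> C A \<longleftrightarrow>
     \<beta> (Suc L) = 0 \<and>
     (\<forall>i<L. \<forall>p\<in>{1..\<beta> i}. \<forall>j\<in>{1..\<beta> (Suc i)}.
        A (Suc i) p j \<in> poly_ring r \<and>
        (\<forall>a\<in>keys (A (Suc i) p j). wdegree m d a + C p i = C j (Suc i)) \<and>
        lookup (A (Suc i) p j) 0 = 0) \<and>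
     (\<forall>i<L. {v \<in> free_module r (\<beta> (Suc i)). mat_apply (\<beta> i) (\<beta> (Suc i)) (A (Suc i)) v = 0} =
        mat_apply (\<beta> (Suc i)) (\<beta> (Suc (Suc i))) (A (Suc (Suc i))) ` free_module r (\<beta> (Suc (Suc i))))"

lemma minimal_complex_entry:
  assumes "minimal_complex m d r L \<beta> C A" "i < L" "p \<in> {1..\<beta> i}" "j \<in> {1..\<beta> (Suc i)}"
  shows "A (Suc i) p j \<in> poly_ring r"
    "a \<in> keys (A (Suc i) p j) \<Longrightarrow> wdegree m d a + C p i = C j (Suc i)"
    "lookup (A (Suc i) p j) 0 = 0"
  using assms unfolding minimal_complex_def by blast+

lemma minimal_complex_exact:
  assumes "minimal_complex m d r L \<beta> C A" "i < L"
  shows "{v \<in> free_module r (\<beta> (Suc i)). mat_apply (\<beta> i) (\<beta> (Suc i)) (A (Suc i)) v = 0} =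
        mat_apply (\<beta> (Suc i)) (\<beta> (Suc (Suc i))) (A (Suc (Suc i))) ` free_module r (\<beta> (Suc (Suc i)))"
  using assms unfolding minimal_complex_def by blast

lemma msetzero_entry:
  assumes "minimal_complex m d (Suc r) L \<beta> C A" "i < L" "p \<in> {1..\<beta> i}" "j \<in> {1..\<beta> (Suc i)}"
  shows "msetzero (Suc r) (A (Suc i)) p j \<in> poly_ring r"
    "a \<in> keys (msetzero (Suc r) (A (Suc i)) p j) \<Longrightarrow> wdegree m d a + C p i = C j (Suc i)"
    "lookup (msetzero (Suc r) (A (Suc i)) p j) 0 = 0"
  using minimal_complex_entry[OF assms] poly_ring_setzero
  by (simp_all add: msetzero_def) (simp_all add: setzero_def keys_pfilter lookup_pfilter)

text \<open>Discarding F_0 costs one step of length and one variable together. Regularity comes from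
  \<open>regular_on_cokernel\<close>: the new bottom cokernel, that of \<open>A 2\<close>, is
  embedded in F_0 by \<open>A 1\<close>.\<close>

lemma minimal_complex_shift:
  assumes mc: "minimal_complex m d (Suc r) (Suc L) \<beta> C A"
  shows "minimal_complex m d r L (\<lambda>i. \<beta> (Suc i)) (\<lambda>j i. C j (Suc i)) (\<lambda>i. msetzero (Suc r) (A (Suc i)))"
  unfolding minimal_complex_def
proof (intro conjI allI impI)
  show "\<beta> (Suc (Suc L)) = 0" using mc by (simp add: minimal_complex_def)
  fix i assume i: "i < L"
  then show "\<forall>p\<in>{1..\<beta> (Suc i)}. \<forall>j\<in>{1..\<beta> (Suc (Suc i))}.
        msetzero (Suc r) (A (Suc (Suc i))) p j \<in> poly_ring r \<and>
        (\<forall>a\<in>keys (msetzero (Suc r) (A (Suc (Suc i))) p j). wdegree m d a + C p (Suc i) = C j (Suc (Suc i))) \<and>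
        lookup (msetzero (Suc r) (A (Suc (Suc i))) p j) 0 = 0"
    using msetzero_entry[OF mc, of "Suc i"] by auto
  show "{v \<in> free_module r (\<beta> (Suc (Suc i))).
          mat_apply (\<beta> (Suc i)) (\<beta> (Suc (Suc i))) (msetzero (Suc r) (A (Suc (Suc i)))) v = 0} =
         mat_apply (\<beta> (Suc (Suc i))) (\<beta> (Suc (Suc (Suc i)))) (msetzero (Suc r) (A (Suc (Suc (Suc i))))) `
         free_module r (\<beta> (Suc (Suc (Suc i))))"
  proof (rule exact_setzero)
    show "A (Suc (Suc i)) p j \<in> poly_ring (Suc r)"
      if "p \<in> {1..\<beta> (Suc i)}" "j \<in> {1..\<beta> (Suc (Suc i))}" for p j
      using minimal_complex_entry(1)[OF mc, of "Suc i"] that i by auto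
    show "{v \<in> free_module (Suc r) (\<beta> (Suc (Suc i))).
          mat_apply (\<beta> (Suc i)) (\<beta> (Suc (Suc i))) (A (Suc (Suc i))) v = 0} =
         mat_apply (\<beta> (Suc (Suc i))) (\<beta> (Suc (Suc (Suc i)))) (A (Suc (Suc (Suc i)))) `
         free_module (Suc r) (\<beta> (Suc (Suc (Suc i))))"
      using minimal_complex_exact[OF mc, of "Suc i"] i by simp
    show "w \<in> mat_apply (\<beta> (Suc i)) (\<beta> (Suc (Suc i))) (A (Suc (Suc i))) ` free_module (Suc r) (\<beta> (Suc (Suc i)))"
      if "w \<in> free_module (Suc r) (\<beta> (Suc i))"
        "vmul (Var (Suc r)) w \<in> mat_apply (\<beta> (Suc i)) (\<beta> (Suc (Suc i))) (A (Suc (Suc i))) ` free_module (Suc r) (\<beta> (Suc (Suc i)))" for w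
      using regular_on_cokernel[OF minimal_complex_exact[OF mc, of i] that] i by simp
  qed
qed

text \<open>With F_0 kept, the length stays while a variable is lost. No differential of the complex
  embeds the cokernel of \<open>A 1\<close> in a free module, whence the hypothesis
  \<open>reg\<close>.\<close>

lemma minimal_complex_setzero:
  assumes mc: "minimal_complex m d (Suc r) L \<beta> C A"
    and reg: "\<And>w. w \<in> free_module (Suc r) (\<beta> 0) \<Longrightarrow>
      vmul (Var (Suc r)) w \<in> mat_apply (\<beta> 0) (\<beta> 1) (A 1) ` free_module (Suc r) (\<beta> 1) \<Longrightarrow>
      w \<in> mat_apply (\<beta> 0) (\<beta> 1) (A 1) ` free_module (Suc r) (\<beta> 1)"
  shows "minimal_complex m d r L \<beta> C (\<lambda>i. msetzero (Suc r) (A i))"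
  unfolding minimal_complex_def
proof (intro conjI allI impI)
  show "\<beta> (Suc L) = 0" using mc by (simp add: minimal_complex_def)
  fix i assume i: "i < L"
  then show "\<forall>p\<in>{1..\<beta> i}. \<forall>j\<in>{1..\<beta> (Suc i)}.
        msetzero (Suc r) (A (Suc i)) p j \<in> poly_ring r \<and>
        (\<forall>a\<in>keys (msetzero (Suc r) (A (Suc i)) p j). wdegree m d a + C p i = C j (Suc i)) \<and>
        lookup (msetzero (Suc r) (A (Suc i)) p j) 0 = 0"
    using msetzero_entry[OF mc, of i] by auto
  show "{v \<in> free_module r (\<beta> (Suc i)).
          mat_apply (\<beta> i) (\<beta> (Suc i)) (msetzero (Suc r) (A (Suc i))) v = 0} =
         mat_apply (\<beta> (Suc i)) (\<beta> (Suc (Suc i))) (msetzero (Suc r) (A (Suc (Suc i)))) `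
         free_module r (\<beta> (Suc (Suc i)))"
  proof (rule exact_setzero)
    show "A (Suc i) p j \<in> poly_ring (Suc r)"
      if "p \<in> {1..\<beta> i}" "j \<in> {1..\<beta> (Suc i)}" for p j
      using minimal_complex_entry(1)[OF mc, of i] that i by auto
    show "{v \<in> free_module (Suc r) (\<beta> (Suc i)).
          mat_apply (\<beta> i) (\<beta> (Suc i)) (A (Suc i)) v = 0} =
         mat_apply (\<beta> (Suc i)) (\<beta> (Suc (Suc i))) (A (Suc (Suc i))) `
         free_module (Suc r) (\<beta> (Suc (Suc i)))"
      using minimal_complex_exact[OF mc, of i] i by simp
    show "w \<in> mat_apply (\<beta> i) (\<beta> (Suc i)) (A (Suc i)) ` free_module (Suc r) (\<beta> (Suc i))"
      if "w \<in> free_module (Suc r) (\<beta> i)"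
        "vmul (Var (Suc r)) w \<in> mat_apply (\<beta> i) (\<beta> (Suc i)) (A (Suc i)) ` free_module (Suc r) (\<beta> (Suc i))" for w
    proof (cases i)
      case 0
      then show ?thesis using reg[of w] that by simp
    next
      case (Suc k)
      then show ?thesis
        using regular_on_cokernel[OF minimal_complex_exact[OF mc, of k]] that i by simp
    qed
  qed
qed

section \<open>Socles and the induction on the number of variables\<close>

lemma wdegree_add: "wdegree m d (a + b) = wdegree m d a + wdegree m d b"
  by (simp add: wdegree_def lookup_add distrib_right sum.distrib)

lemma wdegree_single: "t \<in> {1..m} \<Longrightarrow> wdegree m d (Poly_Mapping.single t n) = n * d t"
  by (simp add: wdegree_def lookup_single when_def if_distrib[of "\<lambda>x. x * _"] sum.delta cong: if_cong)

lemma wdegree_zero [simp]: "wdegree m d 0 = 0"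
  by (simp add: wdegree_def)

text \<open>The preimage, in the free module, of the socle of the cokernel of \<open>M\<close>. No
  quotient is formed; accordingly \<open>socle_basis\<close> speaks of representatives, spanning and
  independent over k modulo the image.\<close>

definition socle ::
  "nat \<Rightarrow> nat \<Rightarrow> nat \<Rightarrow> (nat \<Rightarrow> nat \<Rightarrow> 'k::field mpolynomial) \<Rightarrow> (nat \<Rightarrow> 'k mpolynomial) set"
where
  "socle r a b M = {v \<in> free_module r a. \<forall>t\<in>{1..r}. vmul (Var t) v \<in> mat_apply a b M ` free_module r b}"

definition socle_basis ::
  "nat \<Rightarrow> nat \<Rightarrow> nat \<Rightarrow> (nat \<Rightarrow> nat \<Rightarrow> 'k::field mpolynomial) \<Rightarrow> nat \<Rightarrow>
   (nat \<Rightarrow> nat \<Rightarrow> 'k mpolynomial) \<Rightarrow> bool"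
where
  "socle_basis r a b M n f \<longleftrightarrow>
     (\<forall>j\<in>{1..n}. f j \<in> socle r a b M) \<and>
     (\<forall>v\<in>socle r a b M. \<exists>c. v - (\<Sum>j=1..n. vmul (Const (c j)) (f j)) \<in> mat_apply a b M ` free_module r b) \<and>
     (\<forall>c. (\<Sum>j=1..n. vmul (Const (c j)) (f j)) \<in> mat_apply a b M ` free_module r b \<longrightarrow>
        (\<forall>j\<in>{1..n}. c j = 0))"

text \<open>With no variables the ring is k, the socle is all of F_0, and a matrix without columns
  has zero image; so the unit vectors serve and constant terms are the coordinates.\<close>

lemma socle_basis_zero:
  "socle_basis 0 a 0 M a (\<lambda>j l. if l = j \<and> j \<in> {1..a} then 1 else 0 :: 'k::field mpolynomial)"
proof -
  let ?f = "\<lambda>j l. if l = j \<and> j \<in> {1..a} then 1 else 0 :: 'k mpolynomial"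
  have im: "mat_apply a 0 M ` free_module 0 0 = {0}"
    by (auto simp: free_module_rank_zero)
  have sum: "(\<Sum>j=1..a. vmul (Const (c j)) (?f j)) l = (if l \<in> {1..a} then Const (c l) else 0)" for c l
    by (simp add: sum_fun_apply vmul_def if_distrib[of "(*) _"] sum.delta cong: if_cong)
  have 1: "v - (\<Sum>j=1..a. vmul (Const (lookup (v j) 0)) (?f j)) = 0" if v: "v \<in> free_module 0 a" for v
  proof -
    have "v l = Const (lookup (v l) 0)" if "l \<in> {1..a}" for l
    proof (rule poly_mapping_eqI)
      fix k
      have "k = 0" if "k \<in> keys (v l)"
        using v that \<open>l \<in> {1..a}\<close> by (auto simp: free_module_def poly_ring_def)
      then show "lookup (v l) k = lookup (Const (lookup (v l) 0)) k"
        by (auto simp: Const_def lookup_single when_def in_keys_iff)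
    qed
    then have "v l = (\<Sum>j=1..a. vmul (Const (lookup (v j) 0)) (?f j)) l" for l
      unfolding sum using v by (auto simp: free_module_def)
    then have "v = (\<Sum>j=1..a. vmul (Const (lookup (v j) 0)) (?f j))" by (rule ext)
    then show ?thesis by (rule right_minus_eq[THEN iffD2])
  qed
  have 2: "c j = 0" if "(\<Sum>j=1..a. vmul (Const (c j)) (?f j)) = 0" "j \<in> {1..a}" for c j
    using fun_cong[OF that(1), of j] that(2) unfolding sum
    by (simp add: Const_def) (metis lookup_single_eq lookup_zero)
  have 3: "?f j \<in> free_module 0 a" for j
    by (simp add: free_module_def poly_ring_def)
  show ?thesis
    unfolding socle_basis_def im singleton_iff
  proof (intro conjI ballI allI impI)
    fix j show "?f j \<in> socle 0 a 0 M"
      using 3[of j] by (simp add: socle_def)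
  next
    fix v assume "v \<in> socle 0 a 0 M"
    then have "v \<in> free_module 0 a" by (simp add: socle_def)
    then show "\<exists>c. v - (\<Sum>j=1..a. vmul (Const (c j)) (?f j)) = 0"
      by (intro exI[where x = "\<lambda>j. lookup (v j) 0"] 1)
  next
    fix c j assume "(\<Sum>j=1..a. vmul (Const (c j)) (?f j)) = 0" "j \<in> {1..a}"
    then show "c j = 0" by (rule 2)
  qed
qed

text \<open>Modulo the last variable \<open>M\<close> kills \<open>g\<close>: a remaining variable
  times \<open>g\<close> lies in the image of the reduced \<open>N\<close>, so it goes to zero, and
  the variable cancels in a free module.\<close>

lemma socle_image_divisible:
  fixes M N :: "nat \<Rightarrow> nat \<Rightarrow> 'k::field mpolynomial"
  assumes M: "\<And>p j. p \<in> {1..a} \<Longrightarrow> j \<in> {1..b} \<Longrightarrow> M p j \<in> poly_ring (Suc r)"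
    and M0: "\<And>p j. p \<in> {1..a} \<Longrightarrow> j \<in> {1..b} \<Longrightarrow> lookup (M p j) 0 = 0"
    and ex: "{v \<in> free_module (Suc r) b. mat_apply a b M v = 0} = mat_apply b c N ` free_module (Suc r) c"
    and g: "g \<in> socle r b c (msetzero (Suc r) N)"
  obtains f where "f \<in> free_module (Suc r) a" "mat_apply a b M g = vmul (Var (Suc r)) f"
proof -
  have sub: "free_module r x \<subseteq> (free_module (Suc r) x :: (nat \<Rightarrow> 'k mpolynomial) set)" for x
    by (rule free_module_mono) simp
  have g': "g \<in> free_module r b" using g by (simp add: socle_def)
  have "mat_apply a b (msetzero (Suc r) M) g = 0"
  proof (cases r)
    \<comment> \<open>No variable remains to multiply with. Instead every entry of \<open>M\<close>
      modulo X_1 is a constant, and minimality makes that constant zero.\<close>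
    case 0
    have "setzero (Suc r) (M p j) = 0" if "p \<in> {1..a}" "j \<in> {1..b}" for p j
    proof (rule poly_mapping_eqI)
      fix k
      show "lookup (setzero (Suc r) (M p j)) k = lookup 0 k"
      proof (cases "k \<in> keys (setzero (Suc r) (M p j))")
        case True
        then have "k = 0"
          using poly_ring_setzero[OF M[OF that]] 0 by (auto simp: poly_ring_def)
        then show ?thesis
          using M0[OF that] by (simp add: setzero_def lookup_pfilter)
      qed (simp add: in_keys_iff)
    qed
    then show ?thesis
      by (auto simp: mat_apply_def msetzero_def fun_eq_iff)
  next
    case (Suc _)
    then obtain u where u: "u \<in> free_module r c" "vmul (Var 1) g = mat_apply b c (msetzero (Suc r) N) u"
      using g by (fastforce simp: socle_def)
    have "mat_apply b c (msetzero (Suc r) N) u = vsetzero (Suc r) (mat_apply b c N u)"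
      using mat_apply_vsetzero[of b c "Suc r" N u] u(1) by (simp add: vsetzero_id msetzero_def)
    moreover have "mat_apply a b M (mat_apply b c N u) = 0"
      using u(1) sub ex by blast
    ultimately have "vmul (Var 1) (mat_apply a b (msetzero (Suc r) M) g) = vmul (Var 1) 0"
      using mat_apply_vsetzero[of a b "Suc r" M "mat_apply b c N u"] u(2)
      by (simp add: msetzero_def mat_apply_vmul[symmetric])
    then show ?thesis by (rule vmul_Var_cancel)
  qed
  then have "vsetzero (Suc r) (mat_apply a b M g) = 0"
    using mat_apply_vsetzero[of a b "Suc r" M g] g' by (simp add: vsetzero_id msetzero_def)
  moreover obtain f where "f \<in> free_module (Suc r) a"
      "mat_apply a b M g = vsetzero (Suc r) (mat_apply a b M g) + vmul (Var (Suc r)) f"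
    using vsetzero_split[OF mat_apply_in_free_module[of a b M, OF M]] g' sub by (metis subsetD)
  ultimately show thesis using that by simp
qed

lemma vmul_Const_sum_vmul:
  "(\<Sum>j\<in>J. vmul (Const (c j)) (vmul p (f j))) = vmul p (\<Sum>j\<in>J. vmul (Const (c j)) (f j))"
  by (simp add: vmul_sum vmul_commute[of "Const _"])

lemma mat_apply_Const_sum:
  "mat_apply a b M (\<Sum>j\<in>J. vmul (Const (c j)) (g j)) = (\<Sum>j\<in>J. vmul (Const (c j)) (mat_apply a b M (g j)))"
  by (simp only: mat_apply_sum mat_apply_vmul)

lemma free_module_Const_sum:
  "(\<And>j. j \<in> J \<Longrightarrow> g j \<in> free_module r b) \<Longrightarrow> (\<Sum>j\<in>J. vmul (Const (c j)) (g j)) \<in> free_module r b"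
  by (intro free_module_sum free_module_vmul) auto

text \<open>Let $Z \subseteq F_0$ be the image of \<open>M\<close> and $x = x_{r+1}$. Then $f \mapsto x f$ maps the socle of
  $F_0/Z$ isomorphically onto the socle of $Z/xZ$, which is the cokernel of \<open>N\<close> modulo $x$.\<close>

lemma socle_basis_lift:
  fixes M N :: "nat \<Rightarrow> nat \<Rightarrow> 'k::field mpolynomial"
  assumes M: "\<And>p j. p \<in> {1..a} \<Longrightarrow> j \<in> {1..b} \<Longrightarrow> M p j \<in> poly_ring (Suc r)"
    and ex: "{v \<in> free_module (Suc r) b. mat_apply a b M v = 0} = mat_apply b c N ` free_module (Suc r) c"
    and g: "socle_basis r b c (msetzero (Suc r) N) n g"
    and f: "\<And>j. j \<in> {1..n} \<Longrightarrow> f j \<in> free_module (Suc r) a"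
      "\<And>j. j \<in> {1..n} \<Longrightarrow> mat_apply a b M (g j) = vmul (Var (Suc r)) (f j)"
  shows "socle_basis (Suc r) a b M n f"
proof -
  let ?x = "Var (Suc r) :: 'k mpolynomial"
  let ?N = "msetzero (Suc r) N"
  let ?I = "mat_apply a b M ` free_module (Suc r) b"
  have sub: "free_module r x \<subseteq> (free_module (Suc r) x :: (nat \<Rightarrow> 'k mpolynomial) set)" for x
    by (rule free_module_mono) simp
  have x: "?x \<in> poly_ring (Suc r)" by (rule poly_ring_Var) simp
  have gF: "g j \<in> free_module r b" if "j \<in> {1..n}" for j
    using g that by (auto simp: socle_basis_def socle_def)
  have sumF: "(\<Sum>j=1..n. vmul (Const (c j)) (g j)) \<in> free_module r b" for c
    by (rule free_module_Const_sum[OF gF])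
  have Msum: "mat_apply a b M (\<Sum>j=1..n. vmul (Const (c j)) (g j)) =
      vmul ?x (\<Sum>j=1..n. vmul (Const (c j)) (f j))" for c
    unfolding mat_apply_Const_sum vmul_Const_sum_vmul[symmetric]
    by (rule sum.cong) (simp_all only: f)
  have N: "vsetzero (Suc r) (mat_apply b c N u) = mat_apply b c ?N (vsetzero (Suc r) u)" for u
    using mat_apply_vsetzero[of b c "Suc r" N u] by (simp add: msetzero_def)
  \<comment> \<open>Reduction modulo x alters an image vector only by a multiple of x, which
    \<open>M\<close> turns into x times an element of its image.\<close>
  have split: "\<exists>w\<in>free_module (Suc r) b. mat_apply b c ?N u = mat_apply b c N u + vmul ?x w"
    if u: "u \<in> free_module r c" for u
  proof -
    have "mat_apply b c N u \<in> free_module (Suc r) b"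
      using ex u sub by blast
    then obtain w where w: "w \<in> free_module (Suc r) b"
        "mat_apply b c N u = vsetzero (Suc r) (mat_apply b c N u) + vmul ?x w"
      by (rule vsetzero_split)
    then have "mat_apply b c ?N u = mat_apply b c N u + vmul ?x (0 - w)"
      using u by (simp only: N vsetzero_id vmul_diff vmul_zero) (simp add: algebra_simps)
    then show ?thesis
      using free_module_diff[OF free_module_zero w(1)] by (rule bexI)
  qed
  have MN: "mat_apply a b M (mat_apply b c N u) = 0" if "u \<in> free_module (Suc r) c" for u
    using ex that by blast
  show ?thesis
    unfolding socle_basis_def
  proof (intro conjI ballI allI impI)
    fix j assume j: "j \<in> {1..n}"
    show "f j \<in> socle (Suc r) a b M"
      unfolding socle_def
    proof (intro CollectI conjI ballI)
      show "f j \<in> free_module (Suc r) a" using f j by blast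
      fix t assume t: "t \<in> {1..Suc r}"
      show "vmul (Var t) (f j) \<in> ?I"
      proof (cases "t = Suc r")
        case True
        then show ?thesis using f(2)[OF j] gF[OF j] sub by (metis imageI subsetD)
      next
        case False
        then have "t \<in> {1..r}" using t by simp
        then obtain u where u: "u \<in> free_module r c" "vmul (Var t) (g j) = mat_apply b c ?N u"
          using g j unfolding socle_basis_def socle_def by blast
        obtain w where w: "w \<in> free_module (Suc r) b" "mat_apply b c ?N u = mat_apply b c N u + vmul ?x w"
          using split[OF u(1)] by blast
        \<comment> \<open>Since x f_j is the image of g_j under \<open>M\<close>, membership of X_t
          f_j in the image is read off after multiplying by x and cancelling it.\<close>
        have "vmul ?x (vmul (Var t) (f j)) = vmul (Var t) (mat_apply a b M (g j))"
          by (simp only: f(2)[OF j] vmul_commute)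
        also have "\<dots> = mat_apply a b M (mat_apply b c N u + vmul ?x w)"
          by (simp only: mat_apply_vmul[symmetric] u w)
        also have "\<dots> = vmul ?x (mat_apply a b M w)"
          using MN[of u] u(1) sub by (simp only: mat_apply_add mat_apply_vmul) auto
        finally have "vmul (Var t) (f j) = mat_apply a b M w"
          by (rule vmul_Var_cancel)
        then show ?thesis using w by blast
      qed
    qed
  next
    fix y assume y: "y \<in> socle (Suc r) a b M"
    then have yF: "y \<in> free_module (Suc r) a" by (simp add: socle_def)
    have "vmul ?x y \<in> ?I" using y by (simp add: socle_def)
    then obtain v where v: "v \<in> free_module (Suc r) b" "vmul ?x y = mat_apply a b M v" by blast
    \<comment> \<open>Modulo x, the preimage \<open>v\<close> of x y represents the socle element of
      Z/xZ that corresponds to \<open>y\<close>.\<close>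
    have "vsetzero (Suc r) v \<in> socle r b c ?N"
      unfolding socle_def
    proof (intro CollectI conjI ballI)
      show "vsetzero (Suc r) v \<in> free_module r b" by (rule free_module_vsetzero[OF v(1)])
      fix t assume t: "t \<in> {1..r}"
      then have "vmul (Var t) y \<in> ?I" using y by (simp add: socle_def)
      then obtain w where w: "w \<in> free_module (Suc r) b" "vmul (Var t) y = mat_apply a b M w" by blast
      \<comment> \<open>Both terms are sent by \<open>M\<close> to x X_t y, so their difference is a
        syzygy.\<close>
      have "vmul (Var t) v - vmul ?x w \<in> free_module (Suc r) b"
        using v w t by (auto intro!: free_module_diff free_module_vmul poly_ring_Var)
      moreover have "mat_apply a b M (vmul (Var t) v - vmul ?x w) = 0"
        by (simp only: mat_apply_diff mat_apply_vmul v(2)[symmetric] w(2)[symmetric] vmul_commute[of ?x] diff_self)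
      ultimately obtain u where u: "u \<in> free_module (Suc r) c" "vmul (Var t) v - vmul ?x w = mat_apply b c N u"
        using ex by blast
      have "vmul (Var t) (vsetzero (Suc r) v) = vsetzero (Suc r) (vmul (Var t) v - vmul ?x w)"
        using t by (simp add: vsetzero_diff vsetzero_vmul[of _ "Var t"] setzero_Var)
      also have "\<dots> = mat_apply b c ?N (vsetzero (Suc r) u)"
        by (simp only: u N)
      finally show "vmul (Var t) (vsetzero (Suc r) v) \<in> mat_apply b c ?N ` free_module r c"
        using free_module_vsetzero[OF u(1)] by blast
    qed
    then obtain k u where u: "u \<in> free_module r c"
        "vsetzero (Suc r) v - (\<Sum>j=1..n. vmul (Const (k j)) (g j)) = mat_apply b c ?N u"
      using g unfolding socle_basis_def by blast
    obtain w where w: "w \<in> free_module (Suc r) b" "mat_apply b c ?N u = mat_apply b c N u + vmul ?x w"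
      using split[OF u(1)] by blast
    obtain w' where w': "w' \<in> free_module (Suc r) b" "v = vsetzero (Suc r) v + vmul ?x w'"
      using v(1) by (rule vsetzero_split)
    let ?G = "\<Sum>j=1..n. vmul (Const (k j)) (g j)"
    have "v - ?G = (vsetzero (Suc r) v - ?G) + vmul ?x w'"
      by (subst w'(2)) (simp only: add_diff_eq diff_add_eq)
    then have "v - ?G = mat_apply b c N u + vmul ?x (w + w')"
      by (simp only: u(2) w(2) vmul_add add.assoc)
    then have "mat_apply a b M (v - ?G) = mat_apply a b M (mat_apply b c N u) + vmul ?x (mat_apply a b M (w + w'))"
      by (simp only: mat_apply_add mat_apply_vmul)
    then have "vmul ?x (y - (\<Sum>j=1..n. vmul (Const (k j)) (f j))) = vmul ?x (mat_apply a b M (w + w'))"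
      using MN[of u] u(1) sub
      by (simp only: mat_apply_diff v(2)[symmetric] Msum vmul_diff) auto
    then have "y - (\<Sum>j=1..n. vmul (Const (k j)) (f j)) = mat_apply a b M (w + w')"
      by (rule vmul_Var_cancel)
    then show "\<exists>k. y - (\<Sum>j=1..n. vmul (Const (k j)) (f j)) \<in> ?I"
      using free_module_add[OF w(1) w'(1)] by blast
  next
    fix k j assume k: "(\<Sum>j=1..n. vmul (Const (k j)) (f j)) \<in> ?I" and j: "j \<in> {1..n}"
    let ?G = "\<Sum>j=1..n. vmul (Const (k j)) (g j)"
    obtain w where w: "w \<in> free_module (Suc r) b" "(\<Sum>j=1..n. vmul (Const (k j)) (f j)) = mat_apply a b M w"
      using k by blast
    \<comment> \<open>A relation among the f_j, multiplied by x, becomes a syzygy whose reduction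
      modulo x is the same combination of the g_j.\<close>
    have "?G - vmul ?x w \<in> free_module (Suc r) b"
      using sumF[of k] sub w(1) x by (auto intro!: free_module_diff free_module_vmul)
    moreover have "mat_apply a b M (?G - vmul ?x w) = 0"
      by (simp only: mat_apply_diff mat_apply_vmul Msum w(2) diff_self)
    ultimately obtain u where u: "u \<in> free_module (Suc r) c" "?G - vmul ?x w = mat_apply b c N u"
      using ex by blast
    have "?G = vsetzero (Suc r) (?G - vmul ?x w)"
      using sumF[of k] by (simp add: vsetzero_diff vsetzero_id)
    also have "\<dots> = mat_apply b c ?N (vsetzero (Suc r) u)"
      by (simp only: u N)
    finally have "?G \<in> mat_apply b c ?N ` free_module r c"
      using free_module_vsetzero[OF u(1)] by blast
    then show "k j = 0"
      using g j unfolding socle_basis_def by blast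
  qed
qed

text \<open>The shift preserves equality of length and number of variables, so the base case is a
  complex with F_0 alone; the last free module is the same one throughout. Each step back up divides
  by one variable, which takes one d_t off the degree.\<close>

theorem socle_basis_exists:
  fixes A :: "nat \<Rightarrow> nat \<Rightarrow> nat \<Rightarrow> 'k::field mpolynomial"
  assumes "minimal_complex m d r r \<beta> C A" "r \<le> m"
  shows "\<exists>f. socle_basis r (\<beta> 0) (\<beta> 1) (A 1) (\<beta> r) f \<and>
    (\<forall>j\<in>{1..\<beta> r}. \<forall>l\<in>{1..\<beta> 0}. \<forall>a\<in>keys (f j l). wdegree m d a + C l 0 + (\<Sum>t=1..r. d t) = C j r)"
  using assms
proof (induction r arbitrary: \<beta> C A)
  case 0
  then have "\<beta> 1 = 0" by (simp add: minimal_complex_def)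
  then show ?case
    using socle_basis_zero[of "\<beta> 0" "A 1"]
    by (intro exI[of _ "\<lambda>j l. if l = j \<and> j \<in> {1..\<beta> 0} then 1 else 0"]) auto
next
  case (Suc r)
  let ?x = "Var (Suc r) :: 'k mpolynomial"
  note mc = Suc.prems(1)
  obtain g where g: "socle_basis r (\<beta> 1) (\<beta> 2) (msetzero (Suc r) (A 2)) (\<beta> (Suc r)) g"
    and deg: "\<And>j l a. j \<in> {1..\<beta> (Suc r)} \<Longrightarrow> l \<in> {1..\<beta> 1} \<Longrightarrow> a \<in> keys (g j l) \<Longrightarrow>
      wdegree m d a + C l 1 + (\<Sum>t=1..r. d t) = C j (Suc r)"
    using Suc.IH[OF minimal_complex_shift[OF mc]] Suc.prems(2) by (auto simp: numeral_2_eq_2)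
  note entry = minimal_complex_entry[OF mc, of 0, simplified]
  have ex: "{v \<in> free_module (Suc r) (\<beta> 1). mat_apply (\<beta> 0) (\<beta> 1) (A 1) v = 0} =
      mat_apply (\<beta> 1) (\<beta> 2) (A 2) ` free_module (Suc r) (\<beta> 2)"
    using minimal_complex_exact[OF mc, of 0] by (simp add: numeral_2_eq_2)
  have "\<exists>f. f \<in> free_module (Suc r) (\<beta> 0) \<and> mat_apply (\<beta> 0) (\<beta> 1) (A 1) (g j) = vmul ?x f"
    if "j \<in> {1..\<beta> (Suc r)}" for j
  proof -
    have "g j \<in> socle r (\<beta> 1) (\<beta> 2) (msetzero (Suc r) (A 2))"
      using g that by (simp add: socle_basis_def)
    from socle_image_divisible[OF _ _ ex this] entry show ?thesis
      by (metis One_nat_def atLeastAtMost_iff)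
  qed
  then obtain f where f: "\<And>j. j \<in> {1..\<beta> (Suc r)} \<Longrightarrow> f j \<in> free_module (Suc r) (\<beta> 0)"
      "\<And>j. j \<in> {1..\<beta> (Suc r)} \<Longrightarrow> mat_apply (\<beta> 0) (\<beta> 1) (A 1) (g j) = vmul ?x (f j)"
    by metis
  have "socle_basis (Suc r) (\<beta> 0) (\<beta> 1) (A 1) (\<beta> (Suc r)) f"
    using entry by (intro socle_basis_lift[OF _ ex g f]) auto
  moreover have "wdegree m d a + C l 0 + (\<Sum>t=1..Suc r. d t) = C j (Suc r)"
    if j: "j \<in> {1..\<beta> (Suc r)}" and l: "l \<in> {1..\<beta> 0}" and a: "a \<in> keys (f j l)" for j l a
  proof -
    \<comment> \<open>Degrees are compared on one monomial: x times a monomial of f_j must occur in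
      some product of an entry of \<open>A 1\<close> with a component of g_j.\<close>
    have "(\<Sum>q=1..\<beta> 1. A 1 l q * g j q) = ?x * f j l"
      using fun_cong[OF f(2)[OF j], of l] l by (simp add: mat_apply_def vmul_def)
    moreover have "Poly_Mapping.single (Suc r) 1 + a \<in> keys (?x * f j l)"
      using a by (simp only: in_keys_iff lookup_Var_mult not_False_eq_True)
    ultimately obtain q where q: "q \<in> {1..\<beta> 1}" "Poly_Mapping.single (Suc r) 1 + a \<in> keys (A 1 l q * g j q)"
      by (metis (no_types, lifting) in_keys_iff lookup_sum sum.neutral)
    then obtain b c where bc: "b \<in> keys (A 1 l q)" "c \<in> keys (g j q)" "Poly_Mapping.single (Suc r) 1 + a = b + c"
      using keys_mult[of "A 1 l q" "g j q"] by blast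
    have "d (Suc r) + wdegree m d a = wdegree m d b + wdegree m d c"
      using arg_cong[OF bc(3), of "wdegree m d"] Suc.prems(2) by (simp add: wdegree_add wdegree_single)
    moreover have "wdegree m d b + C l 0 = C q 1"
      using entry(2)[of l q b] l q bc by auto
    moreover have "wdegree m d c + C q 1 + (\<Sum>t=1..r. d t) = C j (Suc r)"
      using deg[OF j q(1) bc(2)] .
    ultimately show ?thesis by simp
  qed
  ultimately show ?case by blast
qed


section \<open>The last syzygies of a semigroup ring\<close>

lemma prod_monom_eq: "(\<Prod>i\<in>I. monom 1 (f i)) = (monom 1 (\<Sum>i\<in>I. f i) :: 'k::field poly)"
  by (induction I rule: infinite_finite_induct) (simp_all add: mult_monom)

lemma augmentation_eq:
  "augmentation m d p = (\<Sum>a\<in>keys p. monom (lookup p a) (wdegree m d a))"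
  by (simp add: augmentation_def monom_power prod_monom_eq smult_monom wdegree_def mult.commute)

lemma augmentation_superset:
  "finite K \<Longrightarrow> keys p \<subseteq> K \<Longrightarrow> augmentation m d p = (\<Sum>a\<in>K. monom (lookup p a) (wdegree m d a))"
  unfolding augmentation_eq by (intro sum.mono_neutral_left) (auto simp: in_keys_iff)

lemma augmentation_add: "augmentation m d (p + q) = augmentation m d p + augmentation m d q"
proof -
  let ?K = "keys p \<union> keys q"
  have "augmentation m d (p + q) = (\<Sum>a\<in>?K. monom (lookup (p + q) a) (wdegree m d a))"
    using keys_add[of p q] by (intro augmentation_superset) auto
  also have "\<dots> = (\<Sum>a\<in>?K. monom (lookup p a) (wdegree m d a)) + (\<Sum>a\<in>?K. monom (lookup q a) (wdegree m d a))"
    by (simp add: lookup_add add_monom[symmetric] sum.distrib)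
  finally show ?thesis
    by (simp add: augmentation_superset[of ?K])
qed

lemma augmentation_zero [simp]: "augmentation m d 0 = 0"
  by (simp add: augmentation_eq)

lemma augmentation_diff: "augmentation m d (p - q) = augmentation m d p - augmentation m d q"
  using augmentation_add[of m d "p - q" q] by simp

lemma augmentation_uminus: "augmentation m d (- p) = - augmentation m d p"
  using augmentation_diff[of m d 0 p] by simp

lemma augmentation_sum: "augmentation m d (\<Sum>i\<in>I. f i) = (\<Sum>i\<in>I. augmentation m d (f i))"
  by (induction I rule: infinite_finite_induct) (simp_all add: augmentation_add)

lemma augmentation_single: "augmentation m d (Poly_Mapping.single a c) = monom c (wdegree m d a)"
  by (simp add: augmentation_eq)

lemma augmentation_single_mult:
  "augmentation m d (Poly_Mapping.single s c * p) = monom c (wdegree m d s) * augmentation m d p"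
proof -
  have K: "keys (Poly_Mapping.single s c * p) \<subseteq> (\<lambda>a. s + a) ` keys p"
    using keys_mult[of "Poly_Mapping.single s c" p] by (auto split: if_splits)
  have "augmentation m d (Poly_Mapping.single s c * p) =
      (\<Sum>a\<in>(\<lambda>a. s + a) ` keys p. monom (lookup (Poly_Mapping.single s c * p) a) (wdegree m d a))"
    using K by (intro augmentation_superset) auto
  also have "\<dots> = (\<Sum>a\<in>keys p. monom c (wdegree m d s) * monom (lookup p a) (wdegree m d a))"
    by (subst sum.reindex) (auto simp: inj_on_def lookup_single_mult wdegree_add mult_monom)
  finally show ?thesis
    by (simp add: augmentation_eq sum_distrib_left)
qed

lemma augmentation_Var_mult:
  "t \<in> {1..m} \<Longrightarrow> augmentation m d (Var t * p) = monom 1 (d t) * augmentation m d p"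
  by (simp add: Var_def augmentation_single_mult wdegree_single)

lemma augmentation_Const_mult: "augmentation m d (Const c * p) = smult c (augmentation m d p)"
  by (simp add: Const_def augmentation_single_mult monom_0)

lemma coeff_augmentation_nonzero:
  assumes "coeff (augmentation m d p) e \<noteq> 0" shows "\<exists>a\<in>keys p. wdegree m d a = e"
proof (rule ccontr)
  assume "\<not> ?thesis"
  then have "coeff (augmentation m d p) e = 0"
    unfolding augmentation_eq coeff_sum coeff_monom by (intro sum.neutral) auto
  then show False using assms by contradiction
qed

lemma augmentation_homogeneous:
  assumes "\<And>a. a \<in> keys p \<Longrightarrow> wdegree m d a = e"
  shows "augmentation m d p = monom (coeff (augmentation m d p) e) e"
  using coeff_augmentation_nonzero[of m d p] assms by (auto simp: poly_eq_iff coeff_monom)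

lemma wdegree_in_semigroup: "int (wdegree m d a) \<in> semigroup_of m d"
  unfolding semigroup_of_def wdegree_def by blast

lemma semigroup_monomial:
  assumes "s \<in> semigroup_of m d"
  obtains a where "keys a \<subseteq> {1..m}" "int (wdegree m d a) = s"
proof -
  obtain x :: "nat \<Rightarrow> nat" where x: "s = int (\<Sum>i=1..m. x i * d i)"
    using assms by (auto simp: semigroup_of_def)
  define a where "a = Abs_poly_mapping (\<lambda>i. x i when i \<in> {1..m})"
  have a: "lookup a i = (x i when i \<in> {1..m})" for i
    unfolding a_def by (subst lookup_Abs_poly_mapping) (auto simp: when_def)
  show thesis
  proof
    show "keys a \<subseteq> {1..m}" by (auto simp: in_keys_iff a when_def split: if_splits)
    show "int (wdegree m d a) = s" by (simp add: wdegree_def a x when_def)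
  qed
qed

lemma zero_in_semigroup: "0 \<in> semigroup_of m d"
  using wdegree_in_semigroup[of m d 0] by simp

lemma semigroup_add:
  assumes "s \<in> semigroup_of m d" "s' \<in> semigroup_of m d" shows "s + s' \<in> semigroup_of m d"
proof -
  obtain a b where "int (wdegree m d a) = s" "int (wdegree m d b) = s'"
    using assms semigroup_monomial by metis
  then show ?thesis
    using wdegree_in_semigroup[of m d "a + b"] by (simp add: wdegree_add)
qed

lemma semigroup_nonneg: "s \<in> semigroup_of m d \<Longrightarrow> 0 \<le> s"
  by (auto simp: semigroup_of_def simp del: of_nat_sum)

lemma generator_in_semigroup: "t \<in> {1..m} \<Longrightarrow> int (d t) \<in> semigroup_of m d"
  using wdegree_in_semigroup[of m d "Poly_Mapping.single t 1"] by (simp add: wdegree_single)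

text \<open>A nonzero element of S is a generator plus an element of S, so testing the generators
  suffices.\<close>

lemma pseudo_frobenius_iff:
  assumes "\<And>t. t \<in> {1..m} \<Longrightarrow> 0 < d t"
  shows "x \<in> pseudo_frobenius (semigroup_of m d) \<longleftrightarrow>
    x \<notin> semigroup_of m d \<and> (\<forall>t\<in>{1..m}. x + int (d t) \<in> semigroup_of m d)"
proof -
  have "x + s \<in> semigroup_of m d"
    if x: "\<forall>t\<in>{1..m}. x + int (d t) \<in> semigroup_of m d" and s: "s \<in> semigroup_of m d - {0}" for s
  proof -
    obtain a where a: "keys a \<subseteq> {1..m}" "int (wdegree m d a) = s"
      using s semigroup_monomial by blast
    with s obtain t where "t \<in> keys a"
      by (metis DiffD2 insertI1 keys_eq_empty equals0I of_nat_0 wdegree_zero)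
    then have t: "t \<in> {1..m}" using a(1) by blast
    obtain b where b: "a = Poly_Mapping.single t 1 + b"
      using monomial_split[of a t] \<open>t \<in> keys a\<close> by (auto simp: in_keys_iff)
    have "x + s = (x + int (d t)) + int (wdegree m d b)"
      using t by (simp add: a(2)[symmetric] b wdegree_add wdegree_single)
    moreover have "(x + int (d t)) + int (wdegree m d b) \<in> semigroup_of m d"
      by (rule semigroup_add[OF bspec[OF x t] wdegree_in_semigroup])
    ultimately show ?thesis by (simp only:)
  qed
  moreover have "int (d t) \<in> semigroup_of m d - {0}" if "t \<in> {1..m}" for t
    using assms[OF that] generator_in_semigroup[OF that] by auto
  ultimately show ?thesis
    unfolding pseudo_frobenius_def by blast
qed

text \<open>Here $z^{d_m}$ is regular on $k[S]$, and the socle of $k[S]/z^{d_m}k[S]$ has the basis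
  $z^{x + d_m}$ with $x$ a pseudo-Frobenius number.\<close>

theorem last_syzygies_pseudo_frobenius:
  fixes A :: "nat \<Rightarrow> nat \<Rightarrow> nat \<Rightarrow> 'k::field mpolynomial"
  assumes mc: "minimal_complex m d m r \<beta> C A" and m: "m = Suc r"
    and pos: "\<And>t. t \<in> {1..m} \<Longrightarrow> 0 < d t"
    and b0: "\<beta> 0 = 1" and C0: "C 1 0 = 0"
    and aug: "mat_apply (\<beta> 0) (\<beta> 1) (A 1) ` free_module m (\<beta> 1) =
       {v \<in> free_module m (\<beta> 0). augmentation m d (v 1) = 0}"
  shows "bij_betw (\<lambda>j. int (C j r) - int (\<Sum>t=1..m. d t)) {1..\<beta> r} (pseudo_frobenius (semigroup_of m d))"
proof -
  let ?S = "semigroup_of m d" and ?z = "monom 1 (d m) :: 'k poly" and ?x = "Var m :: 'k mpolynomial"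
  have m1: "m \<in> {1..m}" using m by simp
  \<comment> \<open>The image of \<open>A 1\<close> is the kernel of the augmentation, and
    multiplication by z^(d_m) is injective on polynomials.\<close>
  have reg: "w \<in> mat_apply (\<beta> 0) (\<beta> 1) (A 1) ` free_module m (\<beta> 1)"
    if "w \<in> free_module m (\<beta> 0)" "vmul ?x w \<in> mat_apply (\<beta> 0) (\<beta> 1) (A 1) ` free_module m (\<beta> 1)" for w
    using that unfolding aug by (simp add: vmul_def augmentation_Var_mult[OF m1])
  \<comment> \<open>Length m - 1 over m - 1 variables is the shape \<open>socle_basis_exists\<close>
    demands.\<close>
  have mc': "minimal_complex m d r r \<beta> C (\<lambda>i. msetzero m (A i))"
    using minimal_complex_setzero[of m d r r \<beta> C A] mc reg unfolding m by blast
  define I where "I = mat_apply 1 (\<beta> 1) (msetzero m (A 1)) ` free_module r (\<beta> 1)"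
  obtain f where f: "socle_basis r 1 (\<beta> 1) (msetzero m (A 1)) (\<beta> r) f"
    and deg: "\<And>j a. j \<in> {1..\<beta> r} \<Longrightarrow> a \<in> keys (f j 1) \<Longrightarrow> wdegree m d a + (\<Sum>t=1..r. d t) = C j r"
    using socle_basis_exists[OF mc'] m unfolding b0 by (auto simp: C0[simplified])
  have sub: "free_module r x \<subseteq> (free_module m x :: (nat \<Rightarrow> 'k mpolynomial) set)" for x
    by (rule free_module_mono) (simp add: m)
  have vz: "vsetzero m (mat_apply 1 (\<beta> 1) (A 1) u) = mat_apply 1 (\<beta> 1) (msetzero m (A 1)) (vsetzero m u)" for u
    using mat_apply_vsetzero[of 1 "\<beta> 1" m "A 1" u] by (simp add: msetzero_def)
  \<comment> \<open>This translates the quotient by \<open>I\<close> into k[S] modulo z^(d_m)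
    k[S].\<close>
  have I: "v \<in> I \<longleftrightarrow> (\<exists>h\<in>poly_ring m. augmentation m d (v 1) = ?z * augmentation m d h)"
    if v: "v \<in> free_module r 1" for v
  proof
    assume "v \<in> I"
    then obtain u where u: "u \<in> free_module r (\<beta> 1)" "v = mat_apply 1 (\<beta> 1) (msetzero m (A 1)) u"
      by (auto simp: I_def)
    have Au: "mat_apply 1 (\<beta> 1) (A 1) u \<in> {v \<in> free_module m 1. augmentation m d (v 1) = 0}"
      using aug u(1) sub unfolding b0 by blast
    then obtain w where w: "w \<in> free_module m 1"
        "mat_apply 1 (\<beta> 1) (A 1) u = vsetzero m (mat_apply 1 (\<beta> 1) (A 1) u) + vmul ?x w"
      by (metis (no_types, lifting) mem_Collect_eq vsetzero_split)
    have "vsetzero m u = u" using u(1) m by (simp add: vsetzero_id)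
    then have "mat_apply 1 (\<beta> 1) (A 1) u = v + vmul ?x w"
      using w(2) unfolding vz u(2) by simp
    then have "augmentation m d ((v + vmul ?x w) 1) = 0"
      using Au by simp
    then have "augmentation m d (v 1) = ?z * augmentation m d (0 - w 1)"
      by (simp add: vmul_def augmentation_add augmentation_Var_mult[OF m1] augmentation_uminus eq_neg_iff_add_eq_0)
    moreover have "0 - w 1 \<in> poly_ring m"
      using w(1) by (intro poly_ring_diff) (auto simp: free_module_def)
    ultimately show "\<exists>h\<in>poly_ring m. augmentation m d (v 1) = ?z * augmentation m d h" by blast
  next
    assume "\<exists>h\<in>poly_ring m. augmentation m d (v 1) = ?z * augmentation m d h"
    then obtain h where h: "h \<in> poly_ring m" "augmentation m d (v 1) = ?z * augmentation m d h" by blast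
    let ?h = "\<lambda>j::nat. if j = 1 then h else 0"
    have "v \<in> free_module m 1" "?h \<in> free_module m 1"
      using v sub h(1) by (blast, simp add: free_module_def)
    then have "v - vmul ?x ?h \<in> free_module m 1"
      using m1 by (intro free_module_diff free_module_vmul poly_ring_Var)
    moreover have "augmentation m d ((v - vmul ?x ?h) 1) = 0"
      using h(2) by (simp add: vmul_def augmentation_diff augmentation_Var_mult[OF m1])
    ultimately obtain u where u: "u \<in> free_module m (\<beta> 1)" "v - vmul ?x ?h = mat_apply 1 (\<beta> 1) (A 1) u"
      using aug unfolding b0 by blast
    have "v = vsetzero m (v - vmul ?x ?h)"
      using v m by (simp add: vsetzero_diff vsetzero_id)
    also have "\<dots> = mat_apply 1 (\<beta> 1) (msetzero m (A 1)) (vsetzero m u)"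
      by (simp only: u vz)
    finally show "v \<in> I"
      unfolding I_def using free_module_vsetzero[of u r] u(1) m by blast
  qed
  have fsoc: "f j \<in> free_module r 1" "\<And>t. t \<in> {1..r} \<Longrightarrow> vmul (Var t) (f j) \<in> I" if "j \<in> {1..\<beta> r}" for j
    using f that unfolding socle_basis_def socle_def I_def by blast+
  have fspan: "\<exists>c. v - (\<Sum>j=1..\<beta> r. vmul (Const (c j)) (f j)) \<in> I"
    if "v \<in> free_module r 1" "\<And>t. t \<in> {1..r} \<Longrightarrow> vmul (Var t) v \<in> I" for v
    using f that unfolding socle_basis_def socle_def I_def by blast
  have findep: "c j = 0" if "(\<Sum>j=1..\<beta> r. vmul (Const (c j)) (f j)) \<in> I" "j \<in> {1..\<beta> r}" for c j
    using f that unfolding socle_basis_def I_def by blast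
  \<comment> \<open>The degree of f_j. The subtraction is truncated; \<open>eC\<close> shows that it
    is exact once f_j is known to be nonzero.\<close>
  define e where "e j = C j r - (\<Sum>t=1..r. d t)" for j
  define k where "k j = coeff (augmentation m d (f j 1)) (e j)" for j
  have augf: "augmentation m d (f j 1) = monom (k j) (e j)" if "j \<in> {1..\<beta> r}" for j
    unfolding k_def
  proof (rule augmentation_homogeneous)
    fix a assume "a \<in> keys (f j 1)"
    then show "wdegree m d a = e j" using deg[OF that, of a] unfolding e_def by linarith
  qed
  have aug_sum: "augmentation m d ((\<Sum>j=1..\<beta> r. vmul (Const (c j)) (f j)) 1) =
      (\<Sum>j=1..\<beta> r. monom (c j * k j) (e j))" for c
    unfolding sum_fun_apply augmentation_sum vmul_def augmentation_Const_mult
    by (intro sum.cong) (simp_all only: augf smult_monom)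
  have sumF: "(\<Sum>j=1..\<beta> r. vmul (Const (c j)) (f j)) \<in> free_module r 1" for c
    using fsoc by (intro free_module_Const_sum)
  have coeff_I: "int e \<in> ?S \<and> int e - int (d m) \<in> ?S"
    if vI: "v \<in> I" and v: "v \<in> free_module r 1" and ve: "coeff (augmentation m d (v 1)) e \<noteq> 0" for v e
  proof -
    obtain h where h: "augmentation m d (v 1) = ?z * augmentation m d h"
      using I[OF v] vI by blast
    then have "d m \<le> e" "coeff (augmentation m d h) (e - d m) \<noteq> 0"
      using ve by (auto simp: coeff_monom_mult split: if_splits)
    then obtain a where "wdegree m d a = e - d m"
      using coeff_augmentation_nonzero by blast
    then have s: "int e - int (d m) \<in> ?S"
      using wdegree_in_semigroup[of m d a] \<open>d m \<le> e\<close> by (simp add: of_nat_diff)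
    then show ?thesis
      using semigroup_add[OF s generator_in_semigroup[OF m1]] by simp
  qed
  have monom_I: "v \<in> I" if v: "v \<in> free_module r 1" and vc: "augmentation m d (v 1) = monom c e"
    and ve: "int e - int (d m) \<in> ?S" for v c e
  proof -
    obtain a where a: "keys a \<subseteq> {1..m}" "int (wdegree m d a) = int e - int (d m)"
      using ve semigroup_monomial by metis
    then have "d m + wdegree m d a = e" by simp
    then have "augmentation m d (v 1) = ?z * augmentation m d (Poly_Mapping.single a c)"
      using vc by (simp add: augmentation_single mult_monom)
    then show ?thesis
      using I[OF v] poly_ring_single[OF a(1)] by blast
  qed
  have unit_sum: "(\<Sum>j=1..\<beta> r. vmul (Const (if j = i then c else 0)) (f j)) = vmul (Const c) (f i)"
    if "i \<in> {1..\<beta> r}" for i c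
  proof -
    have "vmul (Const (if j = i then c else 0)) (f j) = (if j = i then vmul (Const c) (f i) else 0)" for j
      by (simp add: vmul_def Const_def fun_eq_iff)
    then show ?thesis using that by (simp only: sum.delta finite_atLeastAtMost if_True)
  qed
  have notI: "f j \<notin> I" if j: "j \<in> {1..\<beta> r}" for j
  proof
    assume "f j \<in> I"
    moreover have "vmul (Const 1) (f j) = f j"
      by (simp add: vmul_def Const_def)
    ultimately have "(\<Sum>i=1..\<beta> r. vmul (Const (if i = j then 1 else 0)) (f i)) \<in> I"
      by (simp only: unit_sum[OF j])
    from findep[OF this j] show False by simp
  qed
  have knz: "k j \<noteq> 0" if j: "j \<in> {1..\<beta> r}" for j
  proof
    assume "k j = 0"
    then have "augmentation m d (f j 1) = ?z * augmentation m d 0"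
      using augf[OF j] by simp
    then show False
      using notI[OF j] I[OF fsoc(1)[OF j]] poly_ring_zero by blast
  qed
  have eC: "e j + (\<Sum>t=1..r. d t) = C j r" if j: "j \<in> {1..\<beta> r}" for j
  proof -
    have "f j 1 \<noteq> 0" using knz[OF j] by (auto simp: k_def)
    then obtain a where "a \<in> keys (f j 1)" by (metis equals0I keys_eq_empty)
    then show ?thesis using deg[OF j, of a] unfolding e_def by linarith
  qed
  have ePF: "int (C j r) - int (\<Sum>t=1..m. d t) = int (e j) - int (d m)" if "j \<in> {1..\<beta> r}" for j
    unfolding m sum.cl_ivl_Suc using eC[OF that] by (simp flip: eC[OF that])
  have eS: "int (e j) \<in> ?S" if j: "j \<in> {1..\<beta> r}" for j
  proof -
    obtain a where "wdegree m d a = e j"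
      using knz[OF j] coeff_augmentation_nonzero[of m d "f j 1" "e j"] by (auto simp: k_def)
    then show ?thesis using wdegree_in_semigroup[of m d a] by simp
  qed
  have "bij_betw (\<lambda>j. int (e j) - int (d m)) {1..\<beta> r} (pseudo_frobenius ?S)"
    unfolding bij_betw_def
  proof (intro conjI set_eqI iffI)
    show "inj_on (\<lambda>j. int (e j) - int (d m)) {1..\<beta> r}"
    proof (rule inj_onI)
      fix i j assume i: "i \<in> {1..\<beta> r}" and j: "j \<in> {1..\<beta> r}"
        and "int (e i) - int (d m) = int (e j) - int (d m)"
      then have ee: "e i = e j" by simp
      show "i = j"
      proof (rule ccontr)
        assume ne: "i \<noteq> j"
        \<comment> \<open>Basis elements of equal degree have proportional augmentations. The
          combination k_j f_i - k_i f_j has augmentation zero, so it lies in \<open>I\<close>,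
          against independence.\<close>
        let ?c = "\<lambda>l. (if l = i then k j else 0) - (if l = j then k i else 0)"
        have "(\<Sum>l=1..\<beta> r. monom (?c l * k l) (e l)) =
            (\<Sum>l=1..\<beta> r. (if l = i then monom (k j * k i) (e i) else 0) - (if l = j then monom (k i * k j) (e j) else 0))"
          using ne by (intro sum.cong) (auto simp: minus_monom)
        also have "\<dots> = 0"
          using i j by (simp add: sum_subtractf ee mult.commute)
        finally have "augmentation m d ((\<Sum>l=1..\<beta> r. vmul (Const (?c l)) (f l)) 1) = ?z * augmentation m d 0"
          by (simp only: aug_sum augmentation_zero mult_zero_right)
        then have "(\<Sum>l=1..\<beta> r. vmul (Const (?c l)) (f l)) \<in> I"
          by (subst I[OF sumF]) (rule bexI[OF _ poly_ring_zero])
        from findep[OF this i] show False using ne knz[OF j] by simp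
      qed
    qed
  next
    fix x assume "x \<in> (\<lambda>j. int (e j) - int (d m)) ` {1..\<beta> r}"
    then obtain j where j: "j \<in> {1..\<beta> r}" "x = int (e j) - int (d m)" by blast
    have "x \<notin> ?S"
      using notI[OF j(1)] monom_I[OF fsoc(1)[OF j(1)] augf[OF j(1)]] j(2) by blast
    moreover have "x + int (d t) \<in> ?S" if t: "t \<in> {1..m}" for t
    proof (cases "t = m")
      case True
      then show ?thesis using eS[OF j(1)] j(2) by simp
    next
      case False
      then have t': "t \<in> {1..r}" using t m by simp
      \<comment> \<open>X_t f_j lies in \<open>I\<close>, so its nonzero term of degree d_t + e_j is
        divisible by z^(d_m) within k[S]; this puts x + d_t in S.\<close>
      have "augmentation m d (vmul (Var t) (f j) 1) = monom (k j) (d t + e j)"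
        using augf[OF j(1)] t by (simp add: vmul_def augmentation_Var_mult mult_monom)
      then have "coeff (augmentation m d (vmul (Var t) (f j) 1)) (d t + e j) \<noteq> 0"
        using knz[OF j(1)] by simp
      note nz = this
      have "x + int (d t) = int (d t + e j) - int (d m)" using j(2) by simp
      with coeff_I[OF fsoc(2)[OF j(1) t'] free_module_vmul[OF poly_ring_Var[OF t'] fsoc(1)[OF j(1)]] nz]
      show ?thesis by (simp only:)
    qed
    ultimately show "x \<in> pseudo_frobenius ?S"
      using pseudo_frobenius_iff[of m d x] pos by blast
  next
    fix x assume "x \<in> pseudo_frobenius ?S"
    then have x: "x \<notin> ?S" "\<And>t. t \<in> {1..m} \<Longrightarrow> x + int (d t) \<in> ?S"
      using pseudo_frobenius_iff[of m d x] pos by blast+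
    obtain a where a: "keys a \<subseteq> {1..m}" "int (wdegree m d a) = x + int (d m)"
      using x(2)[OF m1] semigroup_monomial by metis
    \<comment> \<open>A factor X_m in this monomial of degree x + d_m would put x itself in S; so
      only the variables of \<open>poly_ring r\<close> occur.\<close>
    have "m \<notin> keys a"
    proof
      assume "m \<in> keys a"
      then obtain b where "a = Poly_Mapping.single m 1 + b"
        using monomial_split[of a m] by (auto simp: in_keys_iff)
      then have "int (wdegree m d b) = x"
        using a(2) m1 by (simp add: wdegree_add wdegree_single)
      then show False using x(1) wdegree_in_semigroup by metis
    qed
    then have ar: "keys a \<subseteq> {1..r}"
      using a(1) m by (metis atLeastAtMostSuc_conv atLeastAtMost_iff m1 subset_insert)
    define v :: "nat \<Rightarrow> 'k mpolynomial" where "v = (\<lambda>j. if j = 1 then Poly_Mapping.single a 1 else 0)"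
    have v: "v \<in> free_module r 1"
      using poly_ring_single[OF ar] by (auto simp: free_module_def v_def)
    have augv: "augmentation m d (v 1) = monom 1 (wdegree m d a)"
      by (simp add: v_def augmentation_single)
    have "vmul (Var t) v \<in> I" if t: "t \<in> {1..r}" for t
    proof (rule monom_I)
      show "vmul (Var t) v \<in> free_module r 1"
        using v t by (intro free_module_vmul poly_ring_Var)
      show "augmentation m d (vmul (Var t) v 1) = monom 1 (d t + wdegree m d a)"
        using augv t m by (simp add: vmul_def augmentation_Var_mult mult_monom)
      show "int (d t + wdegree m d a) - int (d m) \<in> ?S"
        using x(2)[of t] t m a(2) by (simp add: algebra_simps)
    qed
    then obtain c where c: "v - (\<Sum>j=1..\<beta> r. vmul (Const (c j)) (f j)) \<in> I"
      using fspan[OF v] by blast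
    \<comment> \<open>By \<open>coeff_I\<close> a nonzero coefficient would give x in S. Hence the
      term of \<open>v\<close> is cancelled by some f_j, which then has degree x + d_m.\<close>
    have "coeff (augmentation m d ((v - (\<Sum>j=1..\<beta> r. vmul (Const (c j)) (f j))) 1)) (wdegree m d a) = 0"
    proof (rule ccontr)
      assume "\<not> ?thesis"
      from coeff_I[OF c free_module_diff[OF v sumF] this] show False
        using x(1) a(2) by simp
    qed
    then have "(\<Sum>j=1..\<beta> r. coeff (monom (c j * k j) (e j)) (wdegree m d a)) = 1"
      using augv aug_sum[of c] by (simp add: augmentation_diff coeff_sum)
    then obtain j where j: "j \<in> {1..\<beta> r}" "coeff (monom (c j * k j) (e j)) (wdegree m d a) \<noteq> 0"
      by (metis (no_types, lifting) sum.neutral zero_neq_one)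
    then have "e j = wdegree m d a"
      by (metis coeff_monom)
    then show "x \<in> (\<lambda>j. int (e j) - int (d m)) ` {1..\<beta> r}"
      using j(1) a(2) by (intro image_eqI[of _ _ j]) auto
  qed
  then show ?thesis
    by (rule bij_betw_cong[THEN iffD1, rotated]) (simp only: ePF)
qed


section \<open>Hilbert functions of graded complexes\<close>

text \<open>Rank-nullity relative to a subspace: the ambient space of polynomial vectors is infinite
  dimensional, and only its graded pieces are finitely spanned.\<close>

lemma (in vector_space) dim_kernel_image:
  assumes f: "module_hom scale scale f" and U: "subspace U" and fin: "finite W" "U \<subseteq> span W"
  shows "dim U = dim {u \<in> U. f u = 0} + dim (f ` U)"
proof -
  interpret f: module_hom scale scale f by (rule f)
  let ?K = "{u \<in> U. f u = 0}"
  obtain B0 where B0: "B0 \<subseteq> ?K" "independent B0" "?K \<subseteq> span B0" "card B0 = dim ?K"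
    using basis_exists by blast
  obtain B where B: "B0 \<subseteq> B" "B \<subseteq> U" "independent B" "U \<subseteq> span B"
    using maximal_independent_subset_extend[of B0 U] B0 by blast
  have finB: "finite B"
    using independent_span_bound[OF fin(1) B(3)] B(2) fin(2) by blast
  have spanU: "span (B - B0) \<subseteq> U"
    using B(2) U by (intro span_minimal) auto
  have indep: "independent (B - B0)"
    using B(3) independent_mono by blast
  have inj: "inj_on f (span (B - B0))"
    unfolding f.inj_on_iff_eq_0[OF subspace_span]
  proof (intro ballI impI)
    fix u assume u: "u \<in> span (B - B0)" "f u = 0"
    then have u0: "u \<in> span B0" using spanU B0 by blast
    \<comment> \<open>The coordinates of \<open>u\<close> are supported both on \<open>B0\<close>
      and on its complement in \<open>B\<close>.\<close>
    have "representation B u b = 0" for b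
    proof -
      have "representation B u = representation B0 u"
        using B(3) u0 B(1) by (rule representation_extend)
      moreover have "representation B u = representation (B - B0) u"
        using B(3) Diff_subset u(1) by (intro representation_extend)
      ultimately show ?thesis
        by (metis DiffD2 representation_ne_zero)
    qed
    then show "u = 0"
      using sum_nonzero_representation_eq[OF B(3), of u] u(1) spanU B(4) by auto
  qed
  have "dim (f ` U) = card (f ` (B - B0))"
  proof (rule dim_unique)
    show "f ` (B - B0) \<subseteq> f ` U" using B(2) by auto
    show "independent (f ` (B - B0))"
      using f.independent_injective_image[OF indep inj] .
    show "f ` U \<subseteq> span (f ` (B - B0))"
    proof -
      have "f ` U \<subseteq> f ` span B" using B(4) by auto
      also have "\<dots> = span (f ` B)" by (rule f.span_image[symmetric])
      also have "\<dots> \<subseteq> span (f ` (B - B0))"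
      proof (rule span_minimal[OF _ subspace_span])
        show "f ` B \<subseteq> span (f ` (B - B0))"
        proof (rule image_subsetI)
          fix b assume "b \<in> B"
          then show "f b \<in> span (f ` (B - B0))"
          proof (cases "b \<in> B0")
            case True
            then have "f b = 0" using B0(1) by blast
            then show ?thesis by (simp add: span_zero)
          qed (auto intro: span_base)
        qed
      qed
      finally show ?thesis .
    qed
  qed simp
  also have "\<dots> = card (B - B0)"
    using inj span_superset by (intro card_image) (rule inj_on_subset)
  finally have "dim (f ` U) = card B - dim ?K"
    using B0(4) B(1) finB by (simp add: card_Diff_subset finite_subset)
  moreover have "dim U = card B"
    using B by (intro dim_unique) auto
  moreover have "card B0 \<le> card B"
    using B(1) finB by (rule card_mono[rotated])
  ultimately show ?thesis using B0(4) by simp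
qed

lemma Const_add: "Const (a + b) = Const a + Const b"
  and Const_mult: "Const (a * b) = Const a * Const b"
  and Const_one: "Const 1 = 1"
  by (simp_all add: Const_def single_add mult_single)

text \<open>A single k-space containing all the F_i, so that kernels and images of different
  differentials are measured by the same \<open>vec.dim\<close>.\<close>

interpretation vec: vector_space "\<lambda>c. vmul (Const c :: 'k::field mpolynomial)"
  by unfold_locales (auto simp: vmul_def fun_eq_iff Const_add Const_mult Const_one algebra_simps)

lemma module_hom_mat_apply:
  "module_hom (\<lambda>c. vmul (Const c)) (\<lambda>c. vmul (Const c)) (mat_apply a b M)"
  by (simp add: module_hom_def module_hom_axioms_def mat_apply_add mat_apply_vmul vec.module_axioms)

text \<open>The degree is an integer, so shifts by syzygy degrees may go below zero, where there are
  no monomials.\<close>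

definition monomials :: "nat \<Rightarrow> (nat \<Rightarrow> nat) \<Rightarrow> nat \<Rightarrow> int \<Rightarrow> (nat \<Rightarrow>\<^sub>0 nat) set" where
  "monomials m d r x = {a. keys a \<subseteq> {1..r} \<and> int (wdegree m d a) = x}"

lemma monomials_Suc:
  assumes "Suc r \<le> m"
  shows "monomials m d (Suc r) x =
    monomials m d r x \<union> (\<lambda>a. Poly_Mapping.single (Suc r) 1 + a) ` monomials m d (Suc r) (x - int (d (Suc r)))"
    (is "?L = ?A \<union> ?s ` ?B")
proof (intro set_eqI iffI)
  have t: "Suc r \<in> {1..m}" using assms by simp
  fix a assume a: "a \<in> ?L"
  show "a \<in> ?A \<union> ?s ` ?B"
  proof (cases "Suc r \<in> keys a")
    case False
    then show ?thesis
      using a by (auto simp: monomials_def subset_iff) (metis le_SucE)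
  next
    case True
    then obtain b where b: "a = ?s b"
      using monomial_split[of a "Suc r"] by (auto simp: in_keys_iff)
    have "keys b \<subseteq> keys a" by (auto simp: b in_keys_iff lookup_add)
    then have "b \<in> ?B"
      using a t by (auto simp: monomials_def b wdegree_add wdegree_single)
    then show ?thesis using b by blast
  qed
next
  have t: "Suc r \<in> {1..m}" using assms by simp
  fix a assume "a \<in> ?A \<union> ?s ` ?B"
  then show "a \<in> ?L"
  proof
    assume "a \<in> ?A" then show ?thesis by (fastforce simp: monomials_def)
  next
    assume "a \<in> ?s ` ?B"
    then obtain b where b: "a = ?s b" "b \<in> ?B" by blast
    have "keys (?s b) \<subseteq> {Suc r} \<union> keys b"
      using keys_add[of "Poly_Mapping.single (Suc r) 1" b] by auto
    then show ?thesis
      using b t by (auto simp: monomials_def wdegree_add wdegree_single)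
  qed
qed

lemma monomials_zero: "monomials m d 0 x = (if x = 0 then {0} else {})"
  by (auto simp: monomials_def)

lemma monomials_neg: "x < 0 \<Longrightarrow> monomials m d r x = {}"
  by (auto simp: monomials_def)

lemma finite_monomials:
  assumes pos: "\<And>t. t \<in> {1..m} \<Longrightarrow> 0 < d t" and "r \<le> m"
  shows "finite (monomials m d r x)"
  using \<open>r \<le> m\<close>
proof (induction r arbitrary: x)
  case 0
  then show ?case by (simp add: monomials_zero)
next
  case (Suc r)
  show ?case
  proof (induction "nat x" arbitrary: x rule: less_induct)
    case less
    show ?case
    proof (cases "x < 0")
      case True
      then show ?thesis by (simp add: monomials_neg)
    next
      case False
      have "0 < d (Suc r)" using pos Suc.prems by simp
      \<comment> \<open>At x = 0 the measure \<open>nat x\<close> cannot drop, but then the shifted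
        degree is negative and has no monomials.\<close>
      then have "finite (monomials m d (Suc r) (x - int (d (Suc r))))"
        using less[of "x - int (d (Suc r))"] monomials_neg[of "x - int (d (Suc r))" m d "Suc r"] False
        by (cases "x = 0") auto
      then show ?thesis
        using Suc.IH[of x] Suc.prems unfolding monomials_Suc[of r m d x, OF Suc.prems] by simp
    qed
  qed
qed

text \<open>Monomials are sorted by divisibility by X_(r+1); for Hilbert series this reads (1 -
  z^(d_(r+1))) H_(r+1) = H_r.\<close>

lemma card_monomials_Suc:
  assumes pos: "\<And>t. t \<in> {1..m} \<Longrightarrow> 0 < d t" and r: "Suc r \<le> m"
  shows "card (monomials m d (Suc r) x) =
    card (monomials m d r x) + card (monomials m d (Suc r) (x - int (d (Suc r))))"
proof -
  let ?s = "\<lambda>a. Poly_Mapping.single (Suc r) (1::nat) + a"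
  have sk: "Suc r \<in> keys (?s b)" for b :: "nat \<Rightarrow>\<^sub>0 nat"
    by (simp add: in_keys_iff lookup_add)
  have "monomials m d r x \<inter> ?s ` B = {}" for B
  proof -
    have "?s b \<notin> monomials m d r x" for b
      using sk[of b] unfolding monomials_def by (metis (no_types, lifting) atLeastAtMost_iff
        mem_Collect_eq not_less_eq_eq order_refl subsetD)
    then show ?thesis by blast
  qed
  then have "card (monomials m d (Suc r) x) =
      card (monomials m d r x) + card (?s ` monomials m d (Suc r) (x - int (d (Suc r))))"
    unfolding monomials_Suc[of r m d x, OF r] using r
    by (intro card_Un_disjoint finite_imageI finite_monomials[OF pos]) auto
  also have "card (?s ` monomials m d (Suc r) (x - int (d (Suc r)))) =
      card (monomials m d (Suc r) (x - int (d (Suc r))))"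
    by (intro card_image) (simp add: inj_on_def)
  finally show ?thesis .
qed

section \<open>Homogeneous components of graded free modules\<close>

definition graded_part ::
  "nat \<Rightarrow> (nat \<Rightarrow> nat) \<Rightarrow> nat \<Rightarrow> (nat \<Rightarrow> nat) \<Rightarrow> nat \<Rightarrow> (nat \<Rightarrow> 'k::field mpolynomial) set"
where
  "graded_part m d b g c =
     {v \<in> free_module m b. \<forall>j\<in>{1..b}. \<forall>a\<in>keys (v j). wdegree m d a + g j = c}"

definition graded_basis_index ::
  "nat \<Rightarrow> (nat \<Rightarrow> nat) \<Rightarrow> nat \<Rightarrow> (nat \<Rightarrow> nat) \<Rightarrow> nat \<Rightarrow> (nat \<times> (nat \<Rightarrow>\<^sub>0 nat)) set"
where
  "graded_basis_index m d b g c = (SIGMA j:{1..b}. monomials m d m (int c - int (g j)))"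

definition mono_vec :: "nat \<times> (nat \<Rightarrow>\<^sub>0 nat) \<Rightarrow> nat \<Rightarrow> 'k::field mpolynomial" where
  "mono_vec p = (\<lambda>l. if l = fst p then Poly_Mapping.single (snd p) 1 else 0)"

lemma inj_mono_vec: "inj (mono_vec :: _ \<Rightarrow> nat \<Rightarrow> 'k::field mpolynomial)"
proof (rule injI)
  fix p q assume eq: "(mono_vec p :: nat \<Rightarrow> 'k mpolynomial) = mono_vec q"
  have "lookup (mono_vec q (fst p) :: 'k mpolynomial) (snd p) = 1"
    by (simp add: eq[symmetric]) (simp add: mono_vec_def)
  then show "p = q"
    by (auto simp: mono_vec_def lookup_single when_def prod_eq_iff split: if_splits)
qed

lemma lookup_sum_mono_vec:
  assumes "finite P"
  shows "lookup ((\<Sum>p\<in>P. vmul (Const (h p)) (mono_vec p)) l) a = (if (l, a) \<in> P then h (l, a) else 0)"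
proof -
  have "lookup (vmul (Const (h p)) (mono_vec p) l) a = (if p = (l, a) then h (l, a) else 0)" for p
    by (cases p) (auto simp: vmul_def mono_vec_def Const_def mult_single lookup_single when_def)
  then show ?thesis
    using assms by (simp add: sum_fun_apply lookup_sum)
qed

lemma finite_graded_basis_index:
  assumes "\<And>t. t \<in> {1..m} \<Longrightarrow> 0 < d t"
  shows "finite (graded_basis_index m d b g c)"
  unfolding graded_basis_index_def using assms by (intro finite_SigmaI finite_monomials) auto

lemma graded_part_basis:
  fixes m b c :: nat and d g :: "nat \<Rightarrow> nat"
  assumes pos: "\<And>t. t \<in> {1..m} \<Longrightarrow> 0 < d t"
  defines "P \<equiv> graded_basis_index m d b g c"
  shows "mono_vec ` P \<subseteq> (graded_part m d b g c :: (nat \<Rightarrow> 'k::field mpolynomial) set)"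
    "vec.independent (mono_vec ` P :: (nat \<Rightarrow> 'k mpolynomial) set)"
    "graded_part m d b g c \<subseteq> vec.span (mono_vec ` P :: (nat \<Rightarrow> 'k mpolynomial) set)"
proof -
  have fin: "finite P"
    unfolding P_def by (rule finite_graded_basis_index[OF pos])
  show "mono_vec ` P \<subseteq> (graded_part m d b g c :: (nat \<Rightarrow> 'k mpolynomial) set)"
  proof (rule image_subsetI)
    fix p assume "p \<in> P"
    then have "fst p \<in> {1..b}" "keys (snd p) \<subseteq> {1..m}" "wdegree m d (snd p) + g (fst p) = c"
      by (auto simp: P_def graded_basis_index_def monomials_def)
    then show "mono_vec p \<in> (graded_part m d b g c :: (nat \<Rightarrow> 'k mpolynomial) set)"
      using poly_ring_single[of "snd p" m "1 :: 'k"]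
      by (auto simp: graded_part_def free_module_def mono_vec_def split: if_splits)
  qed
  have inj: "inj_on mono_vec P" using inj_mono_vec by (rule inj_on_subset) simp
  show "vec.independent (mono_vec ` P :: (nat \<Rightarrow> 'k mpolynomial) set)"
  proof (rule vec.independent_if_scalars_zero)
    show "finite (mono_vec ` P :: (nat \<Rightarrow> 'k mpolynomial) set)" using fin by simp
    fix h :: "(nat \<Rightarrow> 'k mpolynomial) \<Rightarrow> 'k" and x :: "nat \<Rightarrow> 'k mpolynomial"
    assume s: "(\<Sum>x\<in>mono_vec ` P. vmul (Const (h x)) x) = 0" and x: "x \<in> mono_vec ` P"
    obtain l a where p: "(l, a) \<in> P" "x = mono_vec (l, a)" using x by auto
    have "(\<Sum>p\<in>P. vmul (Const (h (mono_vec p))) (mono_vec p)) = 0"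
      using s by (simp only: sum.reindex[OF inj] comp_def)
    then have "lookup ((\<Sum>p\<in>P. vmul (Const (h (mono_vec p))) (mono_vec p)) l) a = 0"
      by simp
    then show "h x = 0"
      unfolding lookup_sum_mono_vec[OF fin] using p by simp
  qed
  show "graded_part m d b g c \<subseteq> vec.span (mono_vec ` P :: (nat \<Rightarrow> 'k mpolynomial) set)"
  proof
    fix v :: "nat \<Rightarrow> 'k mpolynomial" assume v: "v \<in> graded_part m d b g c"
    have "v l = (\<Sum>p\<in>P. vmul (Const (lookup (v (fst p)) (snd p))) (mono_vec p)) l" for l
    proof (rule poly_mapping_eqI)
      fix a
      have "lookup (v l) a = 0" if "(l, a) \<notin> P"
      proof (rule ccontr)
        assume "lookup (v l) a \<noteq> 0"
        then have a: "a \<in> keys (v l)" by (simp add: in_keys_iff)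
        then have l: "l \<in> {1..b}" using v by (auto simp: graded_part_def free_module_def)
        then have "keys a \<subseteq> {1..m}" "wdegree m d a + g l = c"
          using a v by (auto simp: graded_part_def free_module_def poly_ring_def)
        then show False using that l by (auto simp: P_def graded_basis_index_def monomials_def)
      qed
      then show "lookup (v l) a = lookup ((\<Sum>p\<in>P. vmul (Const (lookup (v (fst p)) (snd p))) (mono_vec p)) l) a"
        unfolding lookup_sum_mono_vec[OF fin] by simp
    qed
    then have "v = (\<Sum>p\<in>P. vmul (Const (lookup (v (fst p)) (snd p))) (mono_vec p))"
      by (rule ext)
    moreover have "(\<Sum>p\<in>P. vmul (Const (lookup (v (fst p)) (snd p))) (mono_vec p)) \<in> vec.span (mono_vec ` P)"
      by (intro vec.span_sum vec.span_scale vec.span_base imageI)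
    ultimately show "v \<in> vec.span (mono_vec ` P)" by metis
  qed
qed

lemma dim_graded_part:
  assumes pos: "\<And>t. t \<in> {1..m} \<Longrightarrow> 0 < d t"
  shows "vec.dim (graded_part m d b g c :: (nat \<Rightarrow> 'k::field mpolynomial) set) =
    (\<Sum>j=1..b. card (monomials m d m (int c - int (g j))))"
proof -
  let ?P = "graded_basis_index m d b g c"
  note basis = graded_part_basis[where ?'k = 'k and b = b and g = g and c = c, OF pos]
  have "vec.dim (graded_part m d b g c :: (nat \<Rightarrow> 'k mpolynomial) set) = card (mono_vec ` ?P :: (nat \<Rightarrow> 'k mpolynomial) set)"
    by (rule vec.dim_unique[OF basis(1,3,2) refl])
  also have "\<dots> = card ?P"
    by (rule card_image[OF inj_on_subset[OF inj_mono_vec subset_UNIV]])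
  also have "\<dots> = (\<Sum>j=1..b. card (monomials m d m (int c - int (g j))))"
    unfolding graded_basis_index_def by (intro card_SigmaI) (auto intro!: finite_monomials[OF pos])
  finally show ?thesis .
qed

lemma subspace_graded_part:
  "vec.subspace (graded_part m d b g c :: (nat \<Rightarrow> 'k::field mpolynomial) set)"
proof (rule vec.subspaceI)
  show "0 \<in> graded_part m d b g c" by (simp add: graded_part_def)
  fix v w :: "nat \<Rightarrow> 'k mpolynomial" assume vw: "v \<in> graded_part m d b g c" "w \<in> graded_part m d b g c"
  then have "v + w \<in> free_module m b" by (simp add: graded_part_def free_module_add)
  moreover have "wdegree m d a + g j = c" if "j \<in> {1..b}" "a \<in> keys ((v + w) j)" for j a
    using vw that keys_add[of "v j" "w j"] by (auto simp: graded_part_def)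
  ultimately show "v + w \<in> graded_part m d b g c" by (simp add: graded_part_def)
next
  fix v :: "nat \<Rightarrow> 'k mpolynomial" and k assume v: "v \<in> graded_part m d b g c"
  then have "vmul (Const k) v \<in> free_module m b"
    by (intro free_module_vmul) (simp_all add: graded_part_def)
  moreover have "wdegree m d a + g j = c" if "j \<in> {1..b}" "a \<in> keys (vmul (Const k) v j)" for j a
    using v that keys_mult[of "Const k" "v j"] by (auto simp: graded_part_def vmul_def Const_def split: if_splits)
  ultimately show "vmul (Const k) v \<in> graded_part m d b g c" by (simp add: graded_part_def)
qed

definition degree_part ::
  "nat \<Rightarrow> (nat \<Rightarrow> nat) \<Rightarrow> (nat \<Rightarrow> nat) \<Rightarrow> nat \<Rightarrow> (nat \<Rightarrow> 'k::field mpolynomial) \<Rightarrow> nat \<Rightarrow> 'k mpolynomial"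
where
  "degree_part m d g c v = (\<lambda>j. pfilter (\<lambda>a. wdegree m d a + g j = c) (v j))"

lemma degree_part_in_graded_part:
  "v \<in> free_module m b \<Longrightarrow> degree_part m d g c v \<in> graded_part m d b g c"
  by (auto simp: graded_part_def degree_part_def free_module_def keys_pfilter poly_ring_pfilter)

lemma degree_part_id:
  assumes "v \<in> graded_part m d b g c" shows "degree_part m d g c v = v"
proof
  fix j show "degree_part m d g c v j = v j"
    using assms unfolding degree_part_def
    by (cases "j \<in> {1..b}") (auto simp: graded_part_def free_module_def intro!: pfilter_id)
qed

lemma mat_apply_degree_part:
  assumes hom: "\<And>p j x. p \<in> {1..a} \<Longrightarrow> j \<in> {1..b} \<Longrightarrow> x \<in> keys (M p j) \<Longrightarrow> wdegree m d x + h p = g j"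
  shows "mat_apply a b M (degree_part m d g c v) = degree_part m d h c (mat_apply a b M v)"
proof
  fix p
  have "M p j * pfilter (\<lambda>x. wdegree m d x + g j = c) (v j) = pfilter (\<lambda>x. wdegree m d x + h p = c) (M p j * v j)"
    if "p \<in> {1..a}" "j \<in> {1..b}" for j
    using hom[OF that] by (intro pfilter_mult[symmetric]) (auto simp: wdegree_add)
  then show "mat_apply a b M (degree_part m d g c v) p = degree_part m d h c (mat_apply a b M v) p"
    by (simp add: mat_apply_def degree_part_def pfilter_sum)
qed

text \<open>\<open>K\<close> is meant to be the kernel of a differential or of the augmentation.
  Projecting any preimage to degree \<open>e\<close> gives a homogeneous preimage, so exactness
  descends to each degree.\<close>

lemma graded_image_kernel:
  fixes M N :: "nat \<Rightarrow> nat \<Rightarrow> 'k::field mpolynomial"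
  assumes N: "\<And>p j x. p \<in> {1..b} \<Longrightarrow> j \<in> {1..c} \<Longrightarrow> x \<in> keys (N p j) \<Longrightarrow> wdegree m d x + g p = k j"
    and ex: "K = mat_apply b c N ` free_module m c" and K: "K \<subseteq> free_module m b"
  shows "mat_apply b c N ` graded_part m d c k e = K \<inter> graded_part m d b g e"
proof (intro set_eqI iffI)
  fix y assume "y \<in> mat_apply b c N ` graded_part m d c k e"
  then obtain u where u: "u \<in> graded_part m d c k e" "y = mat_apply b c N u" by blast
  have "degree_part m d g e y = y"
    using mat_apply_degree_part[of b c N m d g k e u] N degree_part_id[OF u(1)] u(2) by simp
  moreover have "y \<in> K" using ex u by (auto simp: graded_part_def)
  ultimately show "y \<in> K \<inter> graded_part m d b g e"
    using K degree_part_in_graded_part[of y m b d g e] by auto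
next
  fix y assume y: "y \<in> K \<inter> graded_part m d b g e"
  then obtain u where u: "u \<in> free_module m c" "y = mat_apply b c N u" using ex by blast
  have "mat_apply b c N (degree_part m d k e u) = y"
    using mat_apply_degree_part[of b c N m d g k e u] N degree_part_id[of y] y u(2) by auto
  then show "y \<in> mat_apply b c N ` graded_part m d c k e"
    using degree_part_in_graded_part[OF u(1)] by blast
qed

lemma dim_graded_augmentation:
  assumes pos: "\<And>t. t \<in> {1..m} \<Longrightarrow> 0 < d t" and g: "g 1 = 0"
  shows "vec.dim (graded_part m d 1 g c :: (nat \<Rightarrow> 'k::field mpolynomial) set) =
    vec.dim {v \<in> graded_part m d 1 g c. augmentation m d (v 1 :: 'k mpolynomial) = 0} +
    of_bool (int c \<in> semigroup_of m d)"
proof -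
  let ?U = "graded_part m d 1 g c :: (nat \<Rightarrow> 'k mpolynomial) set"
  define u :: "nat \<Rightarrow> 'k mpolynomial" where "u = (\<lambda>j. if j = 1 then 1 else 0)"
  \<comment> \<open>Augmentation values are univariate polynomials. Recording the one relevant
    coefficient as a multiple of the fixed vector \<open>u\<close> gives an endomorphism of the
    space \<open>vec\<close>, to which \<open>vec.dim_kernel_image\<close> applies.\<close>
  define f :: "(nat \<Rightarrow> 'k mpolynomial) \<Rightarrow> nat \<Rightarrow> 'k mpolynomial"
    where "f v = vmul (Const (coeff (augmentation m d (v 1)) c)) u" for v
  have f: "module_hom (\<lambda>c. vmul (Const c)) (\<lambda>c. vmul (Const c)) f"
  proof -
    have "vmul p v 1 = p * v 1" for p :: "'k mpolynomial" and v by (simp add: vmul_def)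
    then show ?thesis
      unfolding module_hom_def module_hom_axioms_def using vec.module_axioms
      by (simp add: f_def augmentation_add augmentation_Const_mult vec.scale_left_distrib vmul_vmul Const_mult)
  qed
  have u0: "u \<noteq> 0" by (auto simp: u_def fun_eq_iff)
  have aug: "augmentation m d (v 1) = monom (coeff (augmentation m d (v 1)) c) c" if "v \<in> ?U" for v
    using that g by (intro augmentation_homogeneous) (auto simp: graded_part_def)
  have ker: "{v \<in> ?U. f v = 0} = {v \<in> ?U. augmentation m d (v 1) = 0}"
  proof (intro Collect_cong conj_cong refl iffI)
    fix v assume "v \<in> ?U" "f v = 0"
    then show "augmentation m d (v 1) = 0"
      using aug[of v] u0 by (simp add: f_def)
  qed (simp add: f_def)
  have "vec.dim (f ` ?U) = of_bool (int c \<in> semigroup_of m d)"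
  proof (cases "int c \<in> semigroup_of m d")
    case True
    then obtain a where a: "keys a \<subseteq> {1..m}" "wdegree m d a = c"
      using semigroup_monomial[of "int c" m d] by (metis of_nat_eq_iff)
    define v :: "nat \<Rightarrow> 'k mpolynomial" where "v = (\<lambda>j. if j = 1 then Poly_Mapping.single a 1 else 0)"
    have "v \<in> ?U"
      using a g poly_ring_single[OF a(1)] by (auto simp: v_def graded_part_def free_module_def)
    moreover have "f v = u"
      by (simp add: f_def v_def augmentation_single a(2) Const_one vmul_def)
    ultimately have "{u} \<subseteq> f ` ?U" by blast
    moreover have "f ` ?U \<subseteq> vec.span {u}"
      by (auto simp: f_def intro: vec.span_scale vec.span_base)
    ultimately have "vec.dim (f ` ?U) = 1"
      using u0 by (intro vec.dim_unique[of "{u}"]) auto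
    then show ?thesis using True by simp
  next
    case False
    have "f v = 0" if "v \<in> ?U" for v
    proof -
      have "coeff (augmentation m d (v 1)) c = 0"
        using False coeff_augmentation_nonzero[of m d "v 1" c] wdegree_in_semigroup by metis
      then show ?thesis by (simp add: f_def)
    qed
    then have "f ` ?U \<subseteq> {0}" by auto
    then have "vec.dim (f ` ?U) = 0"
      using vec.dim_le_card[of "f ` ?U" "{}"] by simp
    then show ?thesis using False by simp
  qed
  moreover have "vec.dim ?U = vec.dim {v \<in> ?U. f v = 0} + vec.dim (f ` ?U)"
    using f subspace_graded_part finite_imageI[OF finite_graded_basis_index[OF pos]]
      graded_part_basis(3)[where ?'k = 'k, OF pos]
    by (rule vec.dim_kernel_image)
  ultimately show ?thesis unfolding ker by simp
qed

text \<open>In a fixed degree, \<open>u i\<close> will be the dimension of F_i, \<open>k i\<close>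
  the rank of the map from F_(i+1) to F_i, and \<open>h\<close> the dimension of the resolved
  module.\<close>

lemma alternating_telescope:
  fixes u k :: "nat \<Rightarrow> int"
  assumes "u 0 = k 0 + h" "\<And>i. i < N \<Longrightarrow> u (Suc i) = k (Suc i) + k i"
  shows "(\<Sum>i\<le>N. (-1) ^ i * u i) = h + (-1) ^ N * k N"
  using assms(2)
proof (induction N)
  case 0
  then show ?case using assms(1) by simp
next
  case (Suc N)
  then show ?case by (simp add: algebra_simps)
qed

theorem hilbert_function_resolution:
  fixes A :: "nat \<Rightarrow> nat \<Rightarrow> nat \<Rightarrow> 'k::field mpolynomial"
  assumes mc: "minimal_complex m d m L \<beta> C A"
    and pos: "\<And>t. t \<in> {1..m} \<Longrightarrow> 0 < d t"
    and b0: "\<beta> 0 = 1" and C0: "C 1 0 = 0" and L: "1 \<le> L"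
    and aug: "mat_apply (\<beta> 0) (\<beta> 1) (A 1) ` free_module m (\<beta> 1) =
       {v \<in> free_module m (\<beta> 0). augmentation m d (v 1) = 0}"
  shows "of_bool (x \<in> semigroup_of m d) =
    (\<Sum>i\<le>L. (-1) ^ i * (\<Sum>j=1..\<beta> i. int (card (monomials m d m (x - int (C j i))))))"
proof (cases "x < 0")
  case True
  then have "monomials m d m (x - int (C j i)) = {}" for i j
    by (intro monomials_neg) simp
  moreover have "x \<notin> semigroup_of m d" using True semigroup_nonneg by force
  ultimately show ?thesis by simp
next
  case False
  then obtain c where c: "x = int c" by (metis nonneg_int_cases not_less)
  let ?U = "\<lambda>i. graded_part m d (\<beta> i) (\<lambda>j. C j i) c :: (nat \<Rightarrow> 'k mpolynomial) set"
  let ?f = "\<lambda>i. mat_apply (\<beta> i) (\<beta> (Suc i)) (A (Suc i))"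
  define k where "k i = int (vec.dim (?f i ` ?U (Suc i)))" for i
  define u where "u i = int (vec.dim (?U i))" for i
  have entry: "wdegree m d y + C p i = C j (Suc i)"
    if "p \<in> {1..\<beta> i}" "j \<in> {1..\<beta> (Suc i)}" "y \<in> keys (A (Suc i) p j)" "i \<le> L" for i p j y
  proof (cases "i < L")
    case True
    then show ?thesis using minimal_complex_entry(2)[OF mc] that by blast
  next
    \<comment> \<open>For i = L the matrix has no columns.\<close>
    case False
    then show ?thesis using mc that by (auto simp: minimal_complex_def)
  qed
  have rank: "u (Suc i) = k (Suc i) + k i" if i: "i < L" for i
  proof -
    have "?f (Suc i) ` ?U (Suc (Suc i)) =
        {v \<in> free_module m (\<beta> (Suc i)). ?f i v = 0} \<inter> ?U (Suc i)"
      using minimal_complex_exact[OF mc i] entry[of _ "Suc i"] i by (intro graded_image_kernel) auto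
    also have "\<dots> = {v \<in> ?U (Suc i). ?f i v = 0}"
      by (auto simp: graded_part_def)
    finally have ker: "{v \<in> ?U (Suc i). ?f i v = 0} = ?f (Suc i) ` ?U (Suc (Suc i))" ..
    have "vec.dim (?U (Suc i)) = vec.dim {v \<in> ?U (Suc i). ?f i v = 0} + vec.dim (?f i ` ?U (Suc i))"
      using module_hom_mat_apply subspace_graded_part finite_imageI[OF finite_graded_basis_index[OF pos]]
        graded_part_basis(3)[where ?'k = 'k, OF pos]
      by (rule vec.dim_kernel_image)
    then show ?thesis by (simp add: u_def k_def ker)
  qed
  have rank0: "u 0 = k 0 + of_bool (x \<in> semigroup_of m d)"
  proof -
    have "?f 0 ` ?U (Suc 0) = {v \<in> free_module m (\<beta> 0). augmentation m d (v 1) = 0} \<inter> ?U 0"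
      using aug entry[of _ 0] by (intro graded_image_kernel) auto
    also have "\<dots> = {v \<in> ?U 0. augmentation m d (v 1) = 0}"
      by (auto simp: graded_part_def)
    finally show ?thesis
      using dim_graded_augmentation[where ?'k = 'k and g = "\<lambda>j. C j 0" and c = c, OF pos] C0
      by (simp add: u_def k_def b0 c)
  qed
  have "k L = 0"
  proof -
    have "\<beta> (Suc L) = 0" using mc by (simp add: minimal_complex_def)
    then have "?f L ` ?U (Suc L) \<subseteq> vec.span {}"
      by (auto simp: graded_part_def free_module_rank_zero)
    then show ?thesis
      using vec.dim_le_card[of "?f L ` ?U (Suc L)" "{}"] by (simp add: k_def)
  qed
  moreover have "u i = (\<Sum>j=1..\<beta> i. int (card (monomials m d m (x - int (C j i)))))" for i
    unfolding u_def using dim_graded_part[where ?'k = 'k and b = "\<beta> i" and g = "\<lambda>j. C j i" and c = c, OF pos] by (simp add: c)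
  ultimately show ?thesis
    using alternating_telescope[of u k _ L, OF rank0 rank] by simp
qed


section \<open>Numerical semigroups\<close>

lemma semigroup_multiple: "s \<in> semigroup_of m d \<Longrightarrow> int k * s \<in> semigroup_of m d"
proof (induction k)
  case 0
  then show ?case by (simp add: zero_in_semigroup)
next
  case (Suc k)
  then have "s + int k * s \<in> semigroup_of m d" by (intro semigroup_add) auto
  then show ?case by (simp add: algebra_simps)
qed

text \<open>The differences of elements of S form a group; its least positive element divides every
  generator, hence is 1.\<close>

lemma semigroup_consecutive:
  assumes "\<And>t. t \<in> {1..m} \<Longrightarrow> 0 < d t" and gcd: "Gcd (d ` {1..m}) = 1"
  shows "\<exists>s\<in>semigroup_of m d. s + 1 \<in> semigroup_of m d"
proof -
  define G where "G = {a - b | a b. a \<in> semigroup_of m d \<and> b \<in> semigroup_of m d}"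
  have diff: "x - y \<in> G" if xy: "x \<in> G" "y \<in> G" for x y
  proof -
    obtain a b a' b' where "a \<in> semigroup_of m d" "b \<in> semigroup_of m d"
        "a' \<in> semigroup_of m d" "b' \<in> semigroup_of m d" "x = a - b" "y = a' - b'"
      using xy unfolding G_def by blast
    then have "x - y = (a + b') - (b + a')" "a + b' \<in> semigroup_of m d" "b + a' \<in> semigroup_of m d"
      by (auto intro: semigroup_add)
    then show ?thesis unfolding G_def by blast
  qed
  have sub: "s \<in> G" if "s \<in> semigroup_of m d" for s
    using that zero_in_semigroup[of m d] unfolding G_def by force
  have mult: "x - int k * g \<in> G" if "x \<in> G" "g \<in> G" for x g k
  proof (induction k)
    case 0
    then show ?case using that by simp
  next
    case (Suc k)
    have "x - int k * g - g \<in> G" using Suc that(2) by (rule diff)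
    then show ?case by (simp add: algebra_simps)
  qed
  have "{1..m} \<noteq> {}"
  proof
    assume "{1..m} = {}" then show False using gcd by (simp only: image_empty Gcd_empty zero_neq_one)
  qed
  then obtain t where "t \<in> {1..m}" by blast
  then have "\<exists>n::nat. 0 < n \<and> int n \<in> G"
    using assms(1) sub[OF generator_in_semigroup] by blast
  define g where "g = (LEAST n::nat. 0 < n \<and> int n \<in> G)"
  have g: "0 < g" "int g \<in> G"
    using LeastI_ex[OF \<open>\<exists>n::nat. 0 < n \<and> int n \<in> G\<close>] unfolding g_def by blast+
  have gmin: "g \<le> n" if "0 < n" "int n \<in> G" for n
    unfolding g_def using that by (intro Least_le) simp
  have "g dvd d t" if t: "t \<in> {1..m}" for t
  proof -
    have "int (d t) - int (d t div g) * int g \<in> G"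
      using mult[OF sub[OF generator_in_semigroup[OF t]] g(2)] by blast
    then have "int (d t mod g) \<in> G"
      by (simp add: zmod_int zdiv_int minus_div_mult_eq_mod)
    then have "d t mod g = 0"
      using gmin[of "d t mod g"] g(1) by (metis bot_nat_0.not_eq_extremum mod_less_divisor not_le)
    then show ?thesis by (simp add: dvd_eq_mod_eq_0)
  qed
  then have "g dvd Gcd (d ` {1..m})" by (intro Gcd_greatest) auto
  then have "1 \<in> G" using gcd g(2) by simp
  then obtain a b where "a \<in> semigroup_of m d" "b \<in> semigroup_of m d" "1 = a - b"
    unfolding G_def by blast
  then show ?thesis by (intro bexI[of _ b]) (auto simp: algebra_simps)
qed

lemma semigroup_cofinite:
  assumes "\<And>t. t \<in> {1..m} \<Longrightarrow> 0 < d t" and "Gcd (d ` {1..m}) = 1"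
  shows "\<exists>N. \<forall>x\<ge>N. x \<in> semigroup_of m d"
proof -
  obtain s where s: "s \<in> semigroup_of m d" "s + 1 \<in> semigroup_of m d"
    using semigroup_consecutive[OF assms] by blast
  have s0: "0 \<le> s" using s(1) by (rule semigroup_nonneg)
  \<comment> \<open>Divide x by s and trade the remainder for copies of s + 1. From s * s on, the
    quotient is at least s and so exceeds the remainder.\<close>
  have "x \<in> semigroup_of m d" if x: "s * s \<le> x" for x
  proof (cases "s = 0")
    case True
    then show ?thesis
      using semigroup_multiple[OF s(2), of "nat x"] x by simp
  next
    case False
    then have pos: "0 < s" using s0 by simp
    have "s \<le> x div s"
      using zdiv_mono1[OF x pos] pos by simp
    then have "0 \<le> x div s - x mod s" "0 \<le> x mod s"
      using pos_mod_bound[OF pos, of x] pos_mod_sign[OF pos, of x] by auto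
    moreover have "x = (x div s - x mod s) * s + (x mod s) * (s + 1)"
      using div_mult_mod_eq[of x s] by (simp add: algebra_simps)
    ultimately show ?thesis
      using semigroup_add[OF semigroup_multiple[OF s(1), of "nat (x div s - x mod s)"]
          semigroup_multiple[OF s(2), of "nat (x mod s)"]] by simp
  qed
  then show ?thesis by blast
qed

lemma frobenius_semigroup:
  assumes "\<And>t. t \<in> {1..m} \<Longrightarrow> 0 < d t" and "Gcd (d ` {1..m}) = 1"
  shows "frobenius (semigroup_of m d) \<notin> semigroup_of m d"
    "frobenius (semigroup_of m d) < x \<Longrightarrow> x \<in> semigroup_of m d"
proof -
  obtain N where N: "\<And>x. N \<le> x \<Longrightarrow> x \<in> semigroup_of m d"
    using semigroup_cofinite[OF assms] by blast
  \<comment> \<open>Starting at -1, which is never in S, keeps this set nonempty even if S contains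
    all nonnegative integers; the Frobenius number is then -1.\<close>
  let ?X = "{x \<in> {-1..N}. x \<notin> semigroup_of m d}"
  have m1: "(-1::int) \<notin> semigroup_of m d" using semigroup_nonneg[of "-1" m d] by auto
  then have "-1 \<le> N" using N[of "-1"] by (meson linear)
  then have "-1 \<in> ?X" using m1 by simp
  have finX: "finite ?X" by (rule finite_subset[of _ "{-1..N}"]) auto
  have M: "Max ?X \<in> ?X" "-1 \<le> Max ?X"
    using Max_in[OF finX] Max_ge[OF finX] \<open>-1 \<in> ?X\<close> by blast+
  have ge: "y \<le> Max ?X" if "y \<notin> semigroup_of m d" for y
  proof (cases "-1 \<le> y")
    case True
    moreover have "y \<le> N" using that N[of y] by (meson linear)
    ultimately have "y \<in> ?X" using that by auto
    then show ?thesis by (rule Max_ge[OF finX])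
  qed (use M(2) in linarith)
  have F: "frobenius (semigroup_of m d) = Max ?X"
    unfolding frobenius_def using M(1) ge by (intro Greatest_equality) auto
  show "frobenius (semigroup_of m d) \<notin> semigroup_of m d" using M(1) unfolding F by blast
  show "x \<in> semigroup_of m d" if "frobenius (semigroup_of m d) < x"
    using ge[of x] that unfolding F by fastforce
qed

text \<open>Both h and F - h are gaps, so neither exceeds F.\<close>

lemma finite_Delta_H:
  assumes "\<And>t. t \<in> {1..m} \<Longrightarrow> 0 < d t" and "Gcd (d ` {1..m}) = 1"
  shows "finite (Delta_H (semigroup_of m d))"
proof (rule finite_subset)
  show "Delta_H (semigroup_of m d) \<subseteq> {0..frobenius (semigroup_of m d)}"
  proof
    fix h assume "h \<in> Delta_H (semigroup_of m d)"
    then have "\<not> frobenius (semigroup_of m d) < h"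
      "\<not> frobenius (semigroup_of m d) < frobenius (semigroup_of m d) - h"
      using frobenius_semigroup(2)[OF assms] by (auto simp: Delta_H_def)
    then show "h \<in> {0..frobenius (semigroup_of m d)}" by auto
  qed
qed simp


section \<open>Generating series and multisets\<close>

text \<open>Applying \<open>alt_diff d r\<close> to a function is multiplying its generating series by
  $\prod_{t=1}^r (1 - z^{d_t})$; the functions need not have bounded support.\<close>

definition alt_diff :: "(nat \<Rightarrow> nat) \<Rightarrow> nat \<Rightarrow> (int \<Rightarrow> int) \<Rightarrow> int \<Rightarrow> int" where
  "alt_diff d r f x = (\<Sum>I\<in>Pow {1..r}. (-1) ^ card I * f (x - int (sum d I)))"

lemma alt_diff_0: "alt_diff d 0 f x = f x"
  by (simp add: alt_diff_def)

lemma alt_diff_Suc: "alt_diff d (Suc r) f x = alt_diff d r f x - alt_diff d r f (x - int (d (Suc r)))"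
proof -
  let ?g = "\<lambda>I. (-1) ^ card I * f (x - int (sum d I))"
  have P: "Pow {1..Suc r} = Pow {1..r} \<union> insert (Suc r) ` Pow {1..r}"
  proof -
    have "{1..Suc r} = insert (Suc r) {1..r}" by auto
    then show ?thesis by (simp only: Pow_insert)
  qed
  have n: "Suc r \<notin> I \<and> finite I" if "I \<in> Pow {1..r}" for I
    using that finite_subset[of I "{1..r}"] by auto
  have "sum ?g (Pow {1..Suc r}) = sum ?g (Pow {1..r}) + sum ?g (insert (Suc r) ` Pow {1..r})"
    unfolding P using n by (intro sum.union_disjoint) auto
  also have "inj_on (insert (Suc r)) (Pow {1..r})"
    using n by (intro inj_onI) (metis insert_ident)
  then have "sum ?g (insert (Suc r) ` Pow {1..r}) = (\<Sum>I\<in>Pow {1..r}. ?g (insert (Suc r) I))"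
    by (simp add: sum.reindex)
  also have "\<dots> = - (\<Sum>I\<in>Pow {1..r}. (-1) ^ card I * f (x - int (d (Suc r)) - int (sum d I)))"
    unfolding sum_negf[symmetric]
  proof (rule sum.cong)
    fix I assume "I \<in> Pow {1..r}"
    then have "Suc r \<notin> I" "finite I" using n by blast+
    then show "?g (insert (Suc r) I) = - ((-1) ^ card I * f (x - int (d (Suc r)) - int (sum d I)))"
      by (simp add: diff_diff_eq)
  qed simp
  finally show ?thesis by (simp add: alt_diff_def)
qed

lemma alt_diff_shift: "alt_diff d r (\<lambda>x. f (x - s)) x = alt_diff d r f (x - s)"
  by (simp add: alt_diff_def algebra_simps)

lemma alt_diff_diff: "alt_diff d r (\<lambda>x. f x - g x) x = alt_diff d r f x - alt_diff d r g x"
  by (simp add: alt_diff_def algebra_simps sum_subtractf)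

lemma alt_diff_sum: "alt_diff d r (\<lambda>x. \<Sum>i\<in>J. f i x) x = (\<Sum>i\<in>J. alt_diff d r (f i) x)"
  unfolding alt_diff_def sum_distrib_left by (rule sum.swap)

lemma alt_diff_mult: "alt_diff d r (\<lambda>x. c * f x) x = c * alt_diff d r f x"
  by (simp add: alt_diff_def sum_distrib_left algebra_simps)

text \<open>Each factor 1 - z^(d_t) kills the series over all integers. This disposes of the 1 in
  h(F - x) = 1 - h(x) - \<delta>(x).\<close>

lemma alt_diff_const: "alt_diff d (Suc r) (\<lambda>x. c) x = 0"
  unfolding alt_diff_Suc by (simp add: alt_diff_def)

text \<open>Putting 1/z into 1 - z^d gives -z^(-d) (1 - z^d); the r factors produce the sign and the
  shift.\<close>

lemma alt_diff_reflect:
  "alt_diff d r (\<lambda>x. f (s - x)) x = (-1) ^ r * alt_diff d r f (s + int (\<Sum>t=1..r. d t) - x)"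
proof (induction r arbitrary: x)
  case 0
  then show ?case by (simp add: alt_diff_0)
next
  case (Suc r)
  have "s + int (\<Sum>t=1..Suc r. d t) - x - int (d (Suc r)) = s + int (\<Sum>t=1..r. d t) - x"
    "s + int (\<Sum>t=1..r. d t) - (x - int (d (Suc r))) = s + int (\<Sum>t=1..Suc r. d t) - x"
    by simp_all
  then show ?case
    unfolding alt_diff_Suc[of _ _ _ x] alt_diff_Suc[of _ _ f] Suc by (simp only:) (simp add: algebra_simps)
qed

text \<open>The Hilbert series of a polynomial ring is the inverse of the product of the 1 -
  z^(d_t); \<open>card_monomials_Suc\<close> removes one factor at a time.\<close>

lemma alt_diff_card_monomials:
  assumes pos: "\<And>t. t \<in> {1..m} \<Longrightarrow> 0 < d t" and r: "r \<le> m"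
  shows "alt_diff d r (\<lambda>x. int (card (monomials m d r x))) x = of_bool (x = 0)"
  using r
proof (induction r arbitrary: x)
  case 0
  then show ?case by (simp add: alt_diff_0 monomials_zero)
next
  case (Suc r)
  let ?N = "\<lambda>x. int (card (monomials m d (Suc r) x))"
  have "alt_diff d (Suc r) ?N x = alt_diff d r (\<lambda>x. ?N x - ?N (x - int (d (Suc r)))) x"
    unfolding alt_diff_Suc alt_diff_diff alt_diff_shift[of _ _ ?N] ..
  also have "(\<lambda>x. ?N x - ?N (x - int (d (Suc r)))) = (\<lambda>x. int (card (monomials m d r x)))"
  proof
    fix x show "?N x - ?N (x - int (d (Suc r))) = int (card (monomials m d r x))"
      using card_monomials_Suc[of m d r x, OF pos Suc.prems] by linarith
  qed
  finally show ?case using Suc by simp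
qed

section \<open>Multiplicities as coefficients\<close>

lemma count_image_mset_set:
  "finite J \<Longrightarrow> int (count (image_mset f (mset_set J)) x) = (\<Sum>j\<in>J. of_bool (x = f j))"
  by (induction J rule: finite_induct) auto

text \<open>Multiplication by P turns the Hilbert series of each free summand into the single term z
  to the power \<open>C j i\<close>.\<close>

lemma alt_diff_semigroup:
  fixes A :: "nat \<Rightarrow> nat \<Rightarrow> nat \<Rightarrow> 'k::field mpolynomial"
  assumes mc: "minimal_complex m d m L \<beta> C A"
    and pos: "\<And>t. t \<in> {1..m} \<Longrightarrow> 0 < d t"
    and b0: "\<beta> 0 = 1" and C0: "C 1 0 = 0" and L: "1 \<le> L"
    and aug: "mat_apply (\<beta> 0) (\<beta> 1) (A 1) ` free_module m (\<beta> 1) =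
       {v \<in> free_module m (\<beta> 0). augmentation m d (v 1) = 0}"
  shows "alt_diff d m (\<lambda>x. of_bool (x \<in> semigroup_of m d)) x =
    (\<Sum>i\<le>L. (-1) ^ i * int (count (B_mset \<beta> C i) x))"
proof -
  have H: "(\<lambda>x. of_bool (x \<in> semigroup_of m d)) =
      (\<lambda>x. \<Sum>i\<le>L. (-1) ^ i * (\<Sum>j=1..\<beta> i. int (card (monomials m d m (x - int (C j i))))))"
    by (rule ext) (rule hilbert_function_resolution[OF mc pos b0 C0 L aug])
  have "alt_diff d m (\<lambda>x. of_bool (x \<in> semigroup_of m d)) x =
      (\<Sum>i\<le>L. (-1) ^ i * (\<Sum>j=1..\<beta> i. alt_diff d m (\<lambda>x. int (card (monomials m d m x))) (x - int (C j i))))"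
    unfolding H alt_diff_sum alt_diff_mult alt_diff_shift[of _ _ "\<lambda>x. int (card (monomials m d m x))"] ..
  also have "\<dots> = (\<Sum>i\<le>L. (-1) ^ i * int (count (B_mset \<beta> C i) x))"
    by (simp only: alt_diff_card_monomials[OF pos order_refl] B_mset_def count_image_mset_set
        finite_atLeastAtMost right_minus_eq)
  finally show ?thesis .
qed

lemma count_L_mset:
  assumes "finite (Delta_H (semigroup_of m d))"
  shows "int (count (L_mset m d i) x) =
    (\<Sum>I | I \<subseteq> {1..m} \<and> card I = i. of_bool (x - int (sum d I) \<in> Delta_H (semigroup_of m d)))"
proof -
  let ?D = "Delta_H (semigroup_of m d)"
  have fin: "finite {I. I \<subseteq> {1..m} \<and> card I = i}"
    by (rule finite_subset[of _ "Pow {1..m}"]) auto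
  have "int (count (L_mset m d i) x) =
      (\<Sum>p\<in>{I. I \<subseteq> {1..m} \<and> card I = i} \<times> ?D. of_bool (x = (case p of (I, h) \<Rightarrow> int (\<Sum>j\<in>I. d j) + h)))"
    unfolding L_mset_def using fin assms by (intro count_image_mset_set) simp
  also have "\<dots> = (\<Sum>I | I \<subseteq> {1..m} \<and> card I = i. \<Sum>h\<in>?D. of_bool (x = int (\<Sum>j\<in>I. d j) + h))"
    by (simp add: sum.cartesian_product case_prod_unfold)
  also have "\<dots> = (\<Sum>I | I \<subseteq> {1..m} \<and> card I = i. of_bool (x - int (sum d I) \<in> ?D))"
  proof (rule sum.cong)
    fix I
    have "(\<Sum>h\<in>?D. of_bool (x = int (\<Sum>j\<in>I. d j) + h)) = (\<Sum>h\<in>?D. if h = x - int (sum d I) then 1 else (0::int))"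
      by (intro sum.cong) auto
    then show "(\<Sum>h\<in>?D. of_bool (x = int (\<Sum>j\<in>I. d j) + h)) = (of_bool (x - int (sum d I) \<in> ?D) :: int)"
      using assms by (simp add: sum.delta)
  qed simp
  finally show ?thesis .
qed

lemma alternating_sum_even_odd:
  fixes f :: "nat \<Rightarrow> int"
  assumes "finite J"
  shows "(\<Sum>i\<in>J. (-1) ^ i * f i) = (\<Sum>i\<in>{i\<in>J. even i}. f i) - (\<Sum>i\<in>{i\<in>J. odd i}. f i)"
proof -
  have "(\<Sum>i\<in>J. (-1) ^ i * f i) = (\<Sum>i\<in>J. (if even i then f i else 0) - (if odd i then f i else 0))"
    by (intro sum.cong) auto
  then show ?thesis using assms by (simp add: sum_subtractf sum.inter_filter)
qed

text \<open>P is expanded over subsets grouped by size. Sizes 0 and m stand apart because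
  \<open>L_even\<close> and \<open>L_odd\<close> exclude them.\<close>

lemma alt_diff_Delta_H:
  assumes fin: "finite (Delta_H (semigroup_of m d))" and m: "1 \<le> m"
  defines "\<delta> \<equiv> \<lambda>x. of_bool (x \<in> Delta_H (semigroup_of m d))"
  shows "alt_diff d m \<delta> x = \<delta> x + int (count (L_even m d) x) - int (count (L_odd m d) x) +
    (-1) ^ m * \<delta> (x - int (\<Sum>t=1..m. d t))"
proof -
  let ?g = "\<lambda>I. (-1) ^ card I * \<delta> (x - int (sum d I))"
  have "alt_diff d m \<delta> x = (\<Sum>i\<in>{..m}. sum ?g {I \<in> Pow {1..m}. card I = i})"
    unfolding alt_diff_def
  proof (rule sum.group[symmetric])
    show "card ` Pow {1..m} \<subseteq> {..m}"
      using card_mono[of "{1..m}"] by fastforce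
  qed auto
  also have "\<dots> = (\<Sum>i\<in>{..m}. (-1) ^ i * int (count (L_mset m d i) x))"
    unfolding count_L_mset[OF fin] \<delta>_def sum_distrib_left by (intro sum.cong) auto
  also have "{..m} = {0} \<union> {m} \<union> {1..m - 1}"
    using m by auto
  also have "(\<Sum>i\<in>\<dots>. (-1) ^ i * int (count (L_mset m d i) x)) =
      int (count (L_mset m d 0) x) + (-1) ^ m * int (count (L_mset m d m) x) +
      (\<Sum>i\<in>{1..m - 1}. (-1) ^ i * int (count (L_mset m d i) x))"
    using m by (subst sum.union_disjoint) auto
  also have "{I. I \<subseteq> {1..m} \<and> card I = 0} = {{}}"
    by (auto dest: finite_subset)
  then have "int (count (L_mset m d 0) x) = \<delta> x"
    unfolding count_L_mset[OF fin] \<delta>_def by simp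
  also have "I \<subseteq> {1..m} \<and> card I = m \<longleftrightarrow> I = {1..m}" for I
    using card_subset_eq[of "{1..m}" I] by auto
  then have "int (count (L_mset m d m) x) = \<delta> (x - int (\<Sum>t=1..m. d t))"
    unfolding count_L_mset[OF fin] \<delta>_def by simp
  also have "(\<Sum>i\<in>{1..m - 1}. (-1) ^ i * int (count (L_mset m d i) x)) =
      int (count (L_even m d) x) - int (count (L_odd m d) x)"
    unfolding L_even_def L_odd_def count_sum of_nat_sum by (intro alternating_sum_even_odd) simp
  finally show ?thesis by simp
qed

text \<open>Separates the indices 0 and 2n, which the joins \<open>B_odd\<close> and
  \<open>B_even\<close> leave out.\<close>

lemma alternating_sum_double:
  fixes f :: "nat \<Rightarrow> int"
  assumes "1 \<le> n"
  shows "(\<Sum>i\<le>2 * n. (-1) ^ i * f i) =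
    f 0 - (\<Sum>i=1..n. f (2 * i - 1)) + (\<Sum>i=1..n - 1. f (2 * i)) + f (2 * n)"
  using assms
proof (induction n rule: nat_induct_at_least)
  case base
  then show ?case by (simp add: numeral_2_eq_2)
next
  case (Suc n)
  have "{1..n} = insert n {1..n - 1}" using Suc by auto
  then have "(\<Sum>i=1..n. f (2 * i)) = (\<Sum>i=1..n - 1. f (2 * i)) + f (2 * n)"
    using Suc by simp
  then show ?case using Suc by simp
qed

text \<open>A resolution leaves the rank at index L + 1 open; setting it to zero turns injectivity
  of the last differential into an exactness clause.\<close>

lemma minimal_complex_of_resolution:
  assumes "minimal_graded_free_resolution m d L \<beta> C A"
  shows "minimal_complex m d m L (\<beta>(Suc L := 0)) C A"
  unfolding minimal_complex_def
proof (intro conjI allI impI)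
  note res = assms[unfolded minimal_graded_free_resolution_def graded_free_resolution_def]
  have entries: "\<forall>i\<in>{1..L}. \<forall>r\<in>{1..\<beta> (i - 1)}. \<forall>j\<in>{1..\<beta> i}.
        A i r j \<in> poly_ring m \<and> (\<forall>a\<in>keys (A i r j). wdegree m d a + C r (i - 1) = C j i)"
    and minimal: "\<forall>i\<in>{1..L}. \<forall>r\<in>{1..\<beta> (i - 1)}. \<forall>j\<in>{1..\<beta> i}. lookup (A i r j) 0 = 0"
    and exact: "\<forall>i\<in>{1..<L}.
        mat_apply (\<beta> i) (\<beta> (i + 1)) (A (i + 1)) ` free_module m (\<beta> (i + 1)) =
        {v \<in> free_module m (\<beta> i). mat_apply (\<beta> (i - 1)) (\<beta> i) (A i) v = (\<lambda>_. 0)}"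
    and inj: "{v \<in> free_module m (\<beta> L). mat_apply (\<beta> (L - 1)) (\<beta> L) (A L) v = (\<lambda>_. 0)} = {\<lambda>_. 0}"
    by - (insert res, elim conjE, assumption)+
  fix i assume i: "i < L"
  then have iL: "Suc i \<in> {1..L}" by auto
  show "\<forall>p\<in>{1..(\<beta>(Suc L := 0)) i}. \<forall>j\<in>{1..(\<beta>(Suc L := 0)) (Suc i)}.
        A (Suc i) p j \<in> poly_ring m \<and>
        (\<forall>a\<in>keys (A (Suc i) p j). wdegree m d a + C p i = C j (Suc i)) \<and>
        lookup (A (Suc i) p j) 0 = 0"
    using bspec[OF entries iL] bspec[OF minimal iL] i by simp
  show "{v \<in> free_module m ((\<beta>(Suc L := 0)) (Suc i)).
          mat_apply ((\<beta>(Suc L := 0)) i) ((\<beta>(Suc L := 0)) (Suc i)) (A (Suc i)) v = 0} =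
         mat_apply ((\<beta>(Suc L := 0)) (Suc i)) ((\<beta>(Suc L := 0)) (Suc (Suc i))) (A (Suc (Suc i))) `
         free_module m ((\<beta>(Suc L := 0)) (Suc (Suc i)))"
  proof (cases "Suc i = L")
    case True
    have "{v \<in> free_module m (\<beta> L). mat_apply (\<beta> i) (\<beta> L) (A L) v = 0} = {0}"
      using inj unfolding zero_fun_def True[symmetric] by simp
    then show ?thesis
      using True i by (simp add: free_module_rank_zero)
  next
    case False
    then have "Suc i \<in> {1..<L}" using i by auto
    from bspec[OF exact this] show ?thesis
      unfolding zero_fun_def using i False by simp
  qed
qed simp

theorem lemma7:
  fixes n m :: nat
    and d :: "nat \<Rightarrow> nat"
    and \<beta> :: "nat \<Rightarrow> nat"
    and C :: "nat \<Rightarrow> nat \<Rightarrow> nat"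
    and A :: "nat \<Rightarrow> nat \<Rightarrow> nat \<Rightarrow> 'k::field_char_0 mpolynomial"
  assumes "n \<ge> 1" and "m = 2 * n + 1"
    and "minimal_generators m d"
    and "almost_symmetric (semigroup_of m d)"
    and "minimal_graded_free_resolution m d (m - 1) \<beta> C A"
    and "syzygy_requirements m \<beta> C"
  shows "let M12 = L_even m d \<inter># L_odd m d;
             X12 = (B_odd n \<beta> C + Bbar_even n d \<beta> C) \<inter># (B_even n \<beta> C + Bbar_odd n d \<beta> C)
         in (B_odd n \<beta> C + Bbar_even n d \<beta> C) - X12 = L_even m d - M12 \<and>
            (B_even n \<beta> C + Bbar_odd n d \<beta> C) - X12 = L_odd m d - M12"
proof -
  let ?S = "semigroup_of m d" and ?\<sigma> = "int (\<Sum>t=1..m. d t)"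
  let ?F = "frobenius ?S"
  let ?\<beta> = "\<beta>(Suc (2 * n) := 0)"
  define \<delta> :: "int \<Rightarrow> int" where "\<delta> x = of_bool (x \<in> Delta_H ?S)" for x
  define h :: "int \<Rightarrow> int" where "h x = of_bool (x \<in> ?S)" for x
  define b where "b i x = int (count (B_mset \<beta> C i) x)" for i x
  have pos: "0 < d t" if "t \<in> {1..m}" for t
    using assms(3) that by (simp add: minimal_generators_def)
  have gcd: "Gcd (d ` {1..m}) = 1" using assms(3) by (simp add: minimal_generators_def)
  note F = frobenius_semigroup[OF pos gcd]
  note finD = finite_Delta_H[OF pos gcd]
  have mc: "minimal_complex m d m (2 * n) ?\<beta> C A"
    using minimal_complex_of_resolution[OF assms(5)] assms(2) by simp
  have res: "graded_free_resolution m d (2 * n) \<beta> C A"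
    using assms(5) assms(2) by (simp add: minimal_graded_free_resolution_def)
  have b0: "?\<beta> 0 = 1" and C0: "C 1 0 = 0" and L: "1 \<le> 2 * n"
    using res by (simp_all add: graded_free_resolution_def)
  have aug: "mat_apply (?\<beta> 0) (?\<beta> 1) (A 1) ` free_module m (?\<beta> 1) =
       {v \<in> free_module m (?\<beta> 0). augmentation m d (v 1) = 0}"
  proof -
    have "mat_apply (\<beta> 0) (\<beta> 1) (A 1) ` free_module m (\<beta> 1) =
       {v \<in> free_module m (\<beta> 0). augmentation m d (v 1) = 0}"
      using res unfolding graded_free_resolution_def by blast
    moreover have "?\<beta> 0 = \<beta> 0" "?\<beta> 1 = \<beta> 1" using L by simp_all
    ultimately show ?thesis by (simp only:)
  qed
  have B_eq: "B_mset ?\<beta> C i = B_mset \<beta> C i" if "i \<le> 2 * n" for i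
    using that by (simp add: B_mset_def)
  have Q: "alt_diff d m h x =
      b 0 x - int (count (B_odd n \<beta> C) x) + int (count (B_even n \<beta> C) x) + b (2 * n) x" for x
  proof -
    have "alt_diff d m h x = (\<Sum>i\<le>2 * n. (-1) ^ i * b i x)"
    proof -
      have "alt_diff d m h x = (\<Sum>i\<le>2 * n. (-1) ^ i * int (count (B_mset ?\<beta> C i) x))"
        unfolding h_def[abs_def] by (rule alt_diff_semigroup[OF mc pos b0 C0 L aug])
      also have "\<dots> = (\<Sum>i\<le>2 * n. (-1) ^ i * b i x)"
        unfolding b_def by (rule sum.cong) (simp_all only: B_eq atMost_iff)
      finally show ?thesis .
    qed
    then show ?thesis
      unfolding alternating_sum_double[OF assms(1)]
      by (simp add: b_def B_odd_def B_even_def count_sum)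
  qed
  have b0x: "b 0 x = of_bool (x = 0)" for x
    using b0 C0 by (simp add: b_def B_mset_def)
  have PF: "pseudo_frobenius ?S = insert ?F (Delta_H ?S)" "?F \<notin> Delta_H ?S"
  proof -
    have "?F + s \<in> ?S" if "s \<in> ?S - {0}" for s
      using that semigroup_nonneg[of s m d] F(2)[of "?F + s"] by auto
    then have "?F \<in> pseudo_frobenius ?S"
      using F(1) by (simp add: pseudo_frobenius_def)
    then show "pseudo_frobenius ?S = insert ?F (Delta_H ?S)"
      using assms(4) by (auto simp: almost_symmetric_def)
    show "?F \<notin> Delta_H ?S"
      using zero_in_semigroup by (simp add: Delta_H_def)
  qed
  \<comment> \<open>The bijection makes this the indicator of the pseudo-Frobenius numbers shifted
    by \<open>?\<sigma>\<close>; almost symmetry, through \<open>PF\<close>, splits it into F and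
    \<open>Delta_H\<close>.\<close>
  have last: "b (2 * n) x = of_bool (x - ?\<sigma> = ?F) + \<delta> (x - ?\<sigma>)" for x
  proof -
    let ?c = "\<lambda>j. int (C j (2 * n)) - ?\<sigma>"
    have bij: "bij_betw ?c {1..\<beta> (2 * n)} (pseudo_frobenius ?S)"
      using last_syzygies_pseudo_frobenius[OF mc _ pos b0 C0 aug] assms(2) by simp
    have "b (2 * n) x = (\<Sum>j=1..\<beta> (2 * n). of_bool (x = int (C j (2 * n))))"
      by (simp add: b_def B_mset_def count_image_mset_set)
    also have "\<dots> = (\<Sum>j=1..\<beta> (2 * n). of_bool (x - ?\<sigma> = ?c j))"
      by (intro sum.cong) auto
    also have "\<dots> = (\<Sum>y\<in>pseudo_frobenius ?S. of_bool (x - ?\<sigma> = y))"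
      by (rule sum.reindex_bij_betw[OF bij])
    also have "\<dots> = of_bool (x - ?\<sigma> = ?F) + (\<Sum>y\<in>Delta_H ?S. of_bool (x - ?\<sigma> = y))"
      using finD PF by simp
    also have "(\<Sum>y\<in>Delta_H ?S. of_bool (x - ?\<sigma> = y)) = (\<Sum>y\<in>Delta_H ?S. if x - ?\<sigma> = y then 1 else (0::int))"
      by (intro sum.cong) auto
    also have "\<dots> = \<delta> (x - ?\<sigma>)"
      using finD by (simp add: \<delta>_def)
    finally show ?thesis .
  qed
  \<comment> \<open>At most one of x and F - x is in S, since F is not; neither is exactly when x
    lies in \<open>Delta_H\<close>.\<close>
  have sym: "h (?F - x) = 1 - h x - \<delta> x" for x
    using F(1) semigroup_add[of x m d "?F - x"] by (auto simp: h_def \<delta>_def Delta_H_def)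
  \<comment> \<open>The minus sign is (-1)^m for odd m.\<close>
  have dual: "alt_diff d m h (?F + ?\<sigma> - x) = alt_diff d m h x + alt_diff d m \<delta> x" for x
  proof -
    have "- alt_diff d m h (?F + ?\<sigma> - x) = alt_diff d m (\<lambda>x. h (?F - x)) x"
      using assms(2) by (simp add: alt_diff_reflect)
    also have "\<dots> = alt_diff d m (\<lambda>x. 1) x - alt_diff d m h x - alt_diff d m \<delta> x"
      unfolding sym alt_diff_diff ..
    also have "alt_diff d m (\<lambda>x. 1) x = 0"
      using alt_diff_const[of d "2 * n"] assms(2) by simp
    finally show ?thesis by simp
  qed
  have \<delta>_alt: "alt_diff d m \<delta> x =
      \<delta> x + int (count (L_even m d) x) - int (count (L_odd m d) x) - \<delta> (x - ?\<sigma>)" for x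
    using alt_diff_Delta_H[OF finD, of x] assms(2) by (simp add: \<delta>_def[abs_def])
  have \<delta>_sym: "\<delta> (?F - x) = \<delta> x" for x
    by (auto simp: \<delta>_def Delta_H_def)
  have bar: "count (Bbar_mset m d \<beta> C i) x = count (B_mset \<beta> C i) (?F + ?\<sigma> - x)" for i x
  proof -
    have "int (count (Bbar_mset m d \<beta> C i) x) = int (count (B_mset \<beta> C i) (?F + ?\<sigma> - x))"
      unfolding Bbar_mset_def B_mset_def count_image_mset_set[OF finite_atLeastAtMost]
      by (intro sum.cong) auto
    then show ?thesis by simp
  qed
  have bar_odd: "count (Bbar_odd n d \<beta> C) x = count (B_odd n \<beta> C) (?F + ?\<sigma> - x)"
    and bar_even: "count (Bbar_even n d \<beta> C) x = count (B_even n \<beta> C) (?F + ?\<sigma> - x)" for x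
    by (simp_all only: Bbar_odd_def Bbar_even_def B_odd_def B_even_def count_sum bar assms(2)[symmetric])
  \<comment> \<open>In \<open>dual\<close>, the indicators of x = 0 and x = F +
    \<open>?\<sigma>\<close> occur on both sides, while \<delta>(x) and \<delta>(x -
    \<open>?\<sigma>\<close>) from the last syzygies match the terms of subset size 0 and m in
    \<open>\<delta>_alt\<close>.\<close>
  have key: "count (B_odd n \<beta> C) x + count (Bbar_even n d \<beta> C) x + count (L_odd m d) x =
      count (B_even n \<beta> C) x + count (Bbar_odd n d \<beta> C) x + count (L_even m d) x" for x
  proof -
    have "b (2 * n) (?F + ?\<sigma> - x) = of_bool (x = 0) + \<delta> x"
      using last[of "?F + ?\<sigma> - x"] \<delta>_sym[of x] by simp
    moreover have "b 0 (?F + ?\<sigma> - x) = of_bool (x - ?\<sigma> = ?F)"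
      unfolding b0x by (rule arg_cong[of _ _ of_bool]) auto
    ultimately show ?thesis
      using Q[of x] Q[of "?F + ?\<sigma> - x"] dual[of x] \<delta>_alt[of x] last[of x] b0x[of x]
      unfolding bar_odd bar_even by linarith
  qed
  let ?A = "B_odd n \<beta> C + Bbar_even n d \<beta> C" and ?B = "B_even n \<beta> C + Bbar_odd n d \<beta> C"
  \<comment> \<open>Since a - min(a, b) is the truncated difference, only the value of a - b
    matters, and \<open>key\<close> equates it for the two pairs of multisets.\<close>
  have "?A - (?A \<inter># ?B) = L_even m d - (L_even m d \<inter># L_odd m d)"
  proof (rule multiset_eqI)
    fix x show "count (?A - (?A \<inter># ?B)) x = count (L_even m d - (L_even m d \<inter># L_odd m d)) x"
      using key[of x] by (simp add: min_def; linarith)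
  qed
  moreover have "?B - (?A \<inter># ?B) = L_odd m d - (L_even m d \<inter># L_odd m d)"
  proof (rule multiset_eqI)
    fix x show "count (?B - (?A \<inter># ?B)) x = count (L_odd m d - (L_even m d \<inter># L_odd m d)) x"
      using key[of x] by (simp add: min_def; linarith)
  qed
  ultimately show ?thesis unfolding Let_def by blast
qed

end
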